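(* Let $\alpha=(\alpha_n)_{n\ge1}$ be a strictly increasing, positive, finitely nuclear sequence. Then the Köthe space $\mathcal{K}_{\alpha}$ is nuclear and has the properties $\underline{DN}$ and $\Omega$.
   Context: **Finitely nuclear.** A positive increasing sequence $\alpha$ with $\alpha_n\to+\infty$ is finitely nuclear if the power series space of finite type $\Lambda_1(\alpha)=\{x=(x_n)_{n\ge1}:\sum_n|x_n|e^{-\alpha_n/k}<\infty\ \forall k\ge1\}$ is nuclear, equivalently $\lim_n \ln(n)/\alpha_n=0$. **The space $\mathcal K_\alpha$.** For $s\in\{1,2,\dots\}$ let $I_s=\{\frac{s(s+1)}2+ys+\frac{y(y-1)}2:\ y=0,1,2,\dots\}$. The sets $I_s$ are infinite, pairwise disjoint, and their union is $\{1,2,3,\dots\}$. For $k,n\ge1$ with $n\in I_s$ put $$a_{k,n}=\begin{cases}e^{-\frac1k\alpha_n},&k\le s,\\ e^{(-\frac1k+1)\alpha_n},&k\ge s+1.\end{cases}$$ Then $\mathcal K_\alpha=\{x=(x_n)_{n\ge1}:\|x\|_k=\sum_n|x_n|a_{k,n}<\infty\ \forall k\ge1\}$, a Fréchet space with the seminorms $\|\cdot\|_k$. For a Fréchet space $E$ with increasing fundamental seminorms $(\|\cdot\|_k)$: **Property $\underline{DN}$:** $\exists k\ \forall j\ \exists l,\ C>0,\ 0<\lambda<1$ with $\|x\|_j\le C\|x\|_k^{\lambda}\|x\|_l^{1-\lambda}$ for all $x\in E$. **Property $\Omega$:** $\forall p\ \exists q\ \forall k\ \exists C>0,\ 0<\theta<1$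 with $\|y\|_q^*\le C(\|y\|_p^* )^{1-\theta}(\|y\|_k^* )^{\theta}$ for all $y\in E'$, where $\|y\|_k^*=\sup\{|y(x)|:\|x\|_k\le1\}\in[0,+\infty]$. *)

theory Defs
  imports "HOL-Analysis.Analysis" "HOL-Library.Function_Algebras"
begin

(* Scalars range over a type 'a :: {real_normed_field, banach}; up to isomorphism
   the only such fields are the reals and the complex numbers.  A vector space is a
   carrier set E in an additive group 'v together with a scalar multiplication. *)

section \<open>Seminormed spaces and nuclear maps\<close>

definition linear_functional_on ::
    "('a::real_normed_field \<Rightarrow> 'v::ab_group_add \<Rightarrow> 'v) \<Rightarrow> 'v set \<Rightarrow> ('v \<Rightarrow> 'a) \<Rightarrow> bool" where
  "linear_functional_on scl E f \<longleftrightarrow>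
     (\<forall>x\<in>E. \<forall>y\<in>E. f (x + y) = f x + f y) \<and> (\<forall>c. \<forall>x\<in>E. f (scl c x) = c * f x)"

definition seminorm_on ::
    "('a::real_normed_field \<Rightarrow> 'v::ab_group_add \<Rightarrow> 'v) \<Rightarrow> 'v set \<Rightarrow> ('v \<Rightarrow> real) \<Rightarrow> bool" where
  "seminorm_on scl E p \<longleftrightarrow>
     (\<forall>x\<in>E. 0 \<le> p x) \<and> (\<forall>x\<in>E. \<forall>y\<in>E. p (x + y) \<le> p x + p y) \<and>
     (\<forall>c. \<forall>x\<in>E. p (scl c x) = norm c * p x)"

definition dual_norm :: "'v set \<Rightarrow> ('v \<Rightarrow> real) \<Rightarrow> ('v \<Rightarrow> 'a::real_normed_field) \<Rightarrow> ennreal" where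
  "dual_norm E p f = (SUP x\<in>{x\<in>E. p x \<le> 1}. ennreal (norm (f x)))"

(* T x = (sum over j of phi_j(x) v_j), converging in (F, p), where the phi_j are
   bounded functionals on (E, q) and (sum over j of |phi_j| |v_j|) is finite.
   Passing to the quotients by the kernels of q and p does not affect the notion. *)
definition nuclear_map ::
    "('a::real_normed_field \<Rightarrow> 'v::ab_group_add \<Rightarrow> 'v) \<Rightarrow> 'v set \<Rightarrow> ('v \<Rightarrow> real) \<Rightarrow>
     ('a \<Rightarrow> 'w::ab_group_add \<Rightarrow> 'w) \<Rightarrow> 'w set \<Rightarrow> ('w \<Rightarrow> real) \<Rightarrow> ('v \<Rightarrow> 'w) \<Rightarrow> bool" where
  "nuclear_map sclE E q sclF F p T \<longleftrightarrow>
     (\<exists>(\<phi> :: nat \<Rightarrow> 'v \<Rightarrow> 'a) (v :: nat \<Rightarrow> 'w).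
        (\<forall>j. linear_functional_on sclE E (\<phi> j) \<and> dual_norm E q (\<phi> j) < \<infinity>) \<and>
        (\<forall>j. v j \<in> F) \<and>
        (\<Sum>j. dual_norm E q (\<phi> j) * ennreal (p (v j))) < \<infinity> \<and>
        (\<forall>x\<in>E. (\<lambda>N. p (T x - (\<Sum>j<N. sclF (\<phi> j x) (v j)))) \<longlonglongrightarrow> 0))"

(* The local Banach space of a seminorm p, i.e. the completion of E / ker p, is
   represented by the p-Cauchy sequences in E with the limit seminorm (elements at
   distance 0 are not identified). *)
definition seminorm_completion :: "'v::ab_group_add set \<Rightarrow> ('v \<Rightarrow> real) \<Rightarrow> (nat \<Rightarrow> 'v) set" where
  "seminorm_completion E p =
     {u. (\<forall>m. u m \<in> E) \<and> (\<forall>e>0. \<exists>N. \<forall>m\<ge>N. \<forall>n\<ge>N. p (u m - u n) < e)}"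

definition seminorm_completion_norm :: "('v \<Rightarrow> real) \<Rightarrow> (nat \<Rightarrow> 'v) \<Rightarrow> real" where
  "seminorm_completion_norm p u = lim (\<lambda>m. p (u m))"

definition pointwise_scale :: "('a \<Rightarrow> 'v \<Rightarrow> 'v) \<Rightarrow> 'a \<Rightarrow> ('i \<Rightarrow> 'v) \<Rightarrow> 'i \<Rightarrow> 'v" where
  "pointwise_scale scl c u = (\<lambda>i. scl c (u i))"

section \<open>Spaces with a fundamental system of seminorms\<close>

(* Here P 1 \<le> P 2 \<le> ... is an increasing fundamental system of seminorms on E;
   the value P 0 is never used. *)

definition continuous_seminorm ::
    "('a::real_normed_field \<Rightarrow> 'v::ab_group_add \<Rightarrow> 'v) \<Rightarrow> 'v set \<Rightarrow> (nat \<Rightarrow> 'v \<Rightarrow> real) \<Rightarrow>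
     ('v \<Rightarrow> real) \<Rightarrow> bool" where
  "continuous_seminorm scl E P p \<longleftrightarrow>
     seminorm_on scl E p \<and> (\<exists>k\<ge>1. \<exists>C>0. \<forall>x\<in>E. p x \<le> C * P k x)"

(* If p \<le> q, every q-Cauchy sequence is p-Cauchy, so the canonical map between the
   local Banach spaces of q and p is the identity on representing sequences. *)
definition nuclear_space ::
    "('a::real_normed_field \<Rightarrow> 'v::ab_group_add \<Rightarrow> 'v) \<Rightarrow> 'v set \<Rightarrow> (nat \<Rightarrow> 'v \<Rightarrow> real) \<Rightarrow> bool" where
  "nuclear_space scl E P \<longleftrightarrow>
     (\<forall>p. continuous_seminorm scl E P p \<longrightarrow>
        (\<exists>q. continuous_seminorm scl E P q \<and> (\<forall>x\<in>E. p x \<le> q x) \<and>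
             nuclear_map (pointwise_scale scl) (seminorm_completion E q) (seminorm_completion_norm q)
                         (pointwise_scale scl) (seminorm_completion E p) (seminorm_completion_norm p)
                         (\<lambda>u. u)))"

definition continuous_dual ::
    "('a::real_normed_field \<Rightarrow> 'v::ab_group_add \<Rightarrow> 'v) \<Rightarrow> 'v set \<Rightarrow> (nat \<Rightarrow> 'v \<Rightarrow> real) \<Rightarrow>
     ('v \<Rightarrow> 'a) set" where
  "continuous_dual scl E P =
     {y. linear_functional_on scl E y \<and> (\<exists>k\<ge>1. \<exists>C. \<forall>x\<in>E. norm (y x) \<le> C * P k x)}"

definition property_DN :: "'v set \<Rightarrow> (nat \<Rightarrow> 'v \<Rightarrow> real) \<Rightarrow> bool" where
  "property_DN E P \<longleftrightarrow>
     (\<exists>k\<ge>1. \<forall>j\<ge>1. \<exists>l\<ge>1. \<exists>C>0. \<exists>t. 0 < t \<and> t < 1 \<and>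
        (\<forall>x\<in>E. P j x \<le> C * P k x powr t * P l x powr (1 - t)))"

(* Only used for r > 0, where \<infinity> to the power r is \<infinity>. *)
definition ennpowr :: "ennreal \<Rightarrow> real \<Rightarrow> ennreal" where
  "ennpowr z r = (if z = \<infinity> then \<infinity> else ennreal (enn2real z powr r))"

definition property_Omega ::
    "('a::real_normed_field \<Rightarrow> 'v::ab_group_add \<Rightarrow> 'v) \<Rightarrow> 'v set \<Rightarrow> (nat \<Rightarrow> 'v \<Rightarrow> real) \<Rightarrow> bool" where
  "property_Omega scl E P \<longleftrightarrow>
     (\<forall>p\<ge>1. \<exists>q\<ge>1. \<forall>k\<ge>1. \<exists>C>0. \<exists>\<theta>. 0 < \<theta> \<and> \<theta> < 1 \<and>
        (\<forall>y\<in>continuous_dual scl E P.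
           dual_norm E (P q) y \<le>
             ennreal C * ennpowr (dual_norm E (P p) y) (1 - \<theta>) * ennpowr (dual_norm E (P k) y) \<theta>))"

section \<open>Koethe sequence spaces\<close>

(* A sequence indexed by n \<ge> 1 is a function on nat whose value at 0 is set to 0.
   A k n is the Koethe matrix, k, n \<ge> 1. *)

definition koethe_space :: "(nat \<Rightarrow> nat \<Rightarrow> real) \<Rightarrow> (nat \<Rightarrow> 'a::real_normed_field) set" where
  "koethe_space A = {x. x 0 = 0 \<and> (\<forall>k\<ge>1. (\<lambda>n. norm (x n) * A k n) summable_on {1..})}"

definition koethe_norm :: "(nat \<Rightarrow> nat \<Rightarrow> real) \<Rightarrow> nat \<Rightarrow> (nat \<Rightarrow> 'a::real_normed_field) \<Rightarrow> real" where
  "koethe_norm A k x = (\<Sum>\<^sub>\<infinity>n\<in>{1..}. norm (x n) * A k n)"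

abbreviation seq_scale :: "'a::times \<Rightarrow> (nat \<Rightarrow> 'a) \<Rightarrow> nat \<Rightarrow> 'a" where
  "seq_scale \<equiv> pointwise_scale (*)"

definition finite_type_matrix :: "(nat \<Rightarrow> real) \<Rightarrow> nat \<Rightarrow> nat \<Rightarrow> real" where
  "finite_type_matrix \<alpha> k n = exp (- \<alpha> n / real k)"

(* The type argument is the scalar field. *)
definition finitely_nuclear :: "'a::real_normed_field itself \<Rightarrow> (nat \<Rightarrow> real) \<Rightarrow> bool" where
  "finitely_nuclear _ \<alpha> \<longleftrightarrow>
     (\<forall>n\<ge>1. 0 < \<alpha> n) \<and> mono_on {1..} \<alpha> \<and> filterlim \<alpha> at_top sequentially \<and>
     nuclear_space seq_scale (koethe_space (finite_type_matrix \<alpha>) :: (nat \<Rightarrow> 'a) set)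
       (koethe_norm (finite_type_matrix \<alpha>))"

definition I_set :: "nat \<Rightarrow> nat set" where
  "I_set s = {s * (s + 1) div 2 + y * s + y * (y - 1) div 2 | y. True}"

(* The sets I_set s, s \<ge> 1, partition {1..}. *)
definition I_index :: "nat \<Rightarrow> nat" where
  "I_index n = (THE s. s \<ge> 1 \<and> n \<in> I_set s)"

definition K_matrix :: "(nat \<Rightarrow> real) \<Rightarrow> nat \<Rightarrow> nat \<Rightarrow> real" where
  "K_matrix \<alpha> k n =
     (if k \<le> I_index n then exp (- (1 / real k) * \<alpha> n) else exp ((- (1 / real k) + 1) * \<alpha> n))"

abbreviation K_space :: "(nat \<Rightarrow> real) \<Rightarrow> (nat \<Rightarrow> 'a::real_normed_field) set" where
  "K_space \<alpha> \<equiv> koethe_space (K_matrix \<alpha>)"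

abbreviation K_norm :: "(nat \<Rightarrow> real) \<Rightarrow> nat \<Rightarrow> (nat \<Rightarrow> 'a::real_normed_field) \<Rightarrow> real" where
  "K_norm \<alpha> \<equiv> koethe_norm (K_matrix \<alpha>)"

end

theory Submission
  imports Defs
begin

text \<open>
  All three assertions concern a Koethe space, and for such spaces each of them follows from an inequality between
  the entries of the matrix.

  Nuclearity is governed by the Grothendieck--Pietsch criterion \<open>nuclear_iff_summable_ratio\<close>: the space is nuclear iff
  for every \<open>k\<close> there is an \<open>l \<ge> k\<close> with \<open>\<Sum>\<^sub>n A k n / A l n < \<infinity>\<close>. It is used twice. Applied to the matrix of
  \<open>\<Lambda>\<^sub>1(\<alpha>)\<close>, it turns finite nuclearity of \<open>\<alpha>\<close> into convergence of \<open>\<Sum>\<^sub>n exp (- \<alpha> n / k)\<close> for all \<open>k \<ge> 1\<close>. Applied to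
  \<open>K_matrix \<alpha>\<close>, it turns that convergence into nuclearity, because
  the ratio of the rows \<open>k\<close> and \<open>2 k\<close> is at most \<open>exp (- \<alpha> n / (2 k))\<close>.

  The property \<open>property_DN\<close> follows from \<open>A j n \<le> A 1 n ^ t * A l n ^ (1 - t)\<close> by the Hoelder inequality
  (\<open>norm_interpolation\<close>). For \<open>\<Omega>\<close>, the \<open>k\<close>-th dual norm of \<open>y\<close> is the supremum of \<open>|y(e\<^sub>n)| / A k n\<close> over the unit sequences
  \<open>e\<^sub>n\<close>, so \<open>\<Omega>\<close> follows from \<open>A p n ^ (1 - \<theta>) * A k n ^ \<theta> \<le> A q n\<close> (\<open>dual_norm_interpolation\<close>).

  Write the entries of \<open>K_matrix \<alpha>\<close> as \<open>exp (e\<^sub>k \<alpha> n)\<close>, where \<open>e\<^sub>k = - 1 / k\<close>, increased by 1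
  if \<open>k\<close> exceeds the block index \<open>s\<close> of \<open>n\<close>. Both inequalities become convexity inequalities between exponents. For
  neighbouring indices \<open>e\<^sub>j\<^sub>+\<^sub>1 - e\<^sub>j \<ge> 1 / (j (j + 1))\<close>, whereas no two exponents differ by more than 2. Hence, with \<open>l = j + 1\<close>,
  \<open>q = p + 1\<close> and weight \<open>1 / (2 j (j + 1))\<close> (and \<open>p\<close> for \<open>j\<close> in the case of \<open>\<Omega>\<close>), both inequalities hold
  in every block, with constant 1 (\<open>K_exponent_interpolation\<close>).
\<close>

section \<open>Seminormed spaces and their completions\<close>

locale seminormed_space = module scl
  for scl :: "'a::real_normed_field \<Rightarrow> 'v::ab_group_add \<Rightarrow> 'v" +
  fixes E :: "'v set" and p :: "'v \<Rightarrow> real"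
  assumes subspace: "subspace E" and seminorm: "seminorm_on scl E p"
begin

lemma nonneg: "x \<in> E \<Longrightarrow> 0 \<le> p x"
  and triangle: "x \<in> E \<Longrightarrow> y \<in> E \<Longrightarrow> p (x + y) \<le> p x + p y"
  and homogeneous: "x \<in> E \<Longrightarrow> p (scl c x) = norm c * p x"
  using seminorm by (auto simp: seminorm_on_def)

lemma minus: "x \<in> E \<Longrightarrow> p (- x) = p x"
  using homogeneous[of x "-1"] by simp

lemma zero: "p 0 = 0"
  using homogeneous[of 0 0] subspace_0[OF subspace] by simp

lemma reverse_triangle:
  assumes "x \<in> E" "y \<in> E"
  shows "\<bar>p x - p y\<bar> \<le> p (x - y)"
proof -
  have "x - y \<in> E" "y - x \<in> E"
    using assms subspace_diff[OF subspace] by auto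
  then show ?thesis
    using triangle[of "x - y" y] triangle[of "y - x" x] minus[of "x - y"] assms by auto
qed

lemma completionD:
  assumes "u \<in> seminorm_completion E p"
  shows "u m \<in> E" and "e > 0 \<Longrightarrow> \<exists>N. \<forall>m\<ge>N. \<forall>n\<ge>N. p (u m - u n) < e"
  using assms by (auto simp: seminorm_completion_def)

lemma completion_norm_tendsto:
  assumes u: "u \<in> seminorm_completion E p"
  shows "(\<lambda>m. p (u m)) \<longlonglongrightarrow> seminorm_completion_norm p u"
proof -
  have "Cauchy (\<lambda>m. p (u m))"
  proof (rule metric_CauchyI)
    fix e :: real assume "e > 0"
    then obtain N where N: "\<forall>m\<ge>N. \<forall>n\<ge>N. p (u m - u n) < e"
      using completionD(2)[OF u] by blast
    have "dist (p (u m)) (p (u n)) < e" if "m \<ge> N" "n \<ge> N" for m n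
      using N that reverse_triangle[OF completionD(1)[OF u] completionD(1)[OF u], of m n]
      by (fastforce simp: dist_real_def)
    then show "\<exists>M. \<forall>m\<ge>M. \<forall>n\<ge>M. dist (p (u m)) (p (u n)) < e" by blast
  qed
  then show ?thesis
    unfolding seminorm_completion_norm_def
    using Cauchy_convergent_iff convergent_LIMSEQ_iff by blast
qed

lemma completion_norm_eqI:
  assumes "u \<in> seminorm_completion E p" "(\<lambda>m. p (u m)) \<longlonglongrightarrow> r"
  shows "seminorm_completion_norm p u = r"
  using completion_norm_tendsto[OF assms(1)] assms(2) LIMSEQ_unique by blast

lemma const_in_completion: "x \<in> E \<Longrightarrow> (\<lambda>_. x) \<in> seminorm_completion E p"
  by (simp add: seminorm_completion_def zero)

lemma completion_norm_const: "x \<in> E \<Longrightarrow> seminorm_completion_norm p (\<lambda>_. x) = p x"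
  by (rule completion_norm_eqI[OF const_in_completion]) auto

lemma completion_add:
  assumes u: "u \<in> seminorm_completion E p" and v: "v \<in> seminorm_completion E p"
  shows "u + v \<in> seminorm_completion E p"
  unfolding seminorm_completion_def
proof (intro CollectI conjI allI impI)
  note uE = completionD(1)[OF u] and vE = completionD(1)[OF v]
  show "(u + v) m \<in> E" for m
    using uE vE subspace_add[OF subspace] by simp
  fix e :: real assume "e > 0"
  then obtain M N
    where M: "\<forall>m\<ge>M. \<forall>n\<ge>M. p (u m - u n) < e / 2"
      and N: "\<forall>m\<ge>N. \<forall>n\<ge>N. p (v m - v n) < e / 2"
    using completionD(2)[OF u, of "e/2"] completionD(2)[OF v, of "e/2"] by auto
  have "p ((u + v) m - (u + v) n) < e" if "m \<ge> max M N" "n \<ge> max M N" for m n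
  proof -
    have "(u + v) m - (u + v) n = (u m - u n) + (v m - v n)" by simp
    also have "p \<dots> \<le> p (u m - u n) + p (v m - v n)"
      by (intro triangle subspace_diff[OF subspace] uE vE)
    also have "\<dots> < e / 2 + e / 2"
      using M N that by (intro add_strict_mono) auto
    finally show ?thesis by simp
  qed
  then show "\<exists>N. \<forall>m\<ge>N. \<forall>n\<ge>N. p ((u + v) m - (u + v) n) < e" by blast
qed

lemma completion_scale:
  assumes u: "u \<in> seminorm_completion E p"
  shows "pointwise_scale scl c u \<in> seminorm_completion E p"
  unfolding seminorm_completion_def
proof (intro CollectI conjI allI impI)
  note uE = completionD(1)[OF u]
  show "pointwise_scale scl c u m \<in> E" for m
    using uE subspace_scale[OF subspace] by (simp add: pointwise_scale_def)
  fix e :: real assume e: "e > 0"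
  have c: "norm c + 1 > 0" by (simp add: add_nonneg_pos)
  obtain N where N: "\<forall>m\<ge>N. \<forall>n\<ge>N. p (u m - u n) < e / (norm c + 1)"
    using completionD(2)[OF u, of "e / (norm c + 1)"] e c by auto
  have "p (pointwise_scale scl c u m - pointwise_scale scl c u n) < e"
    if "m \<ge> N" "n \<ge> N" for m n
  proof -
    have d: "u m - u n \<in> E" by (intro subspace_diff[OF subspace] uE)
    have "p (pointwise_scale scl c u m - pointwise_scale scl c u n) = norm c * p (u m - u n)"
      using homogeneous[OF d] by (simp add: pointwise_scale_def scale_right_diff_distrib)
    also have "\<dots> \<le> (norm c + 1) * p (u m - u n)"
      using nonneg[OF d] by (intro mult_right_mono) auto
    also have "\<dots> < e"
      using N that c by (simp add: field_simps)
    finally show ?thesis .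
  qed
  then show "\<exists>N. \<forall>m\<ge>N. \<forall>n\<ge>N.
      p (pointwise_scale scl c u m - pointwise_scale scl c u n) < e" by blast
qed

end

lemma module_pointwise_scale:
  assumes "module scl"
  shows "module (pointwise_scale scl :: 'a::comm_ring_1 \<Rightarrow> ('i \<Rightarrow> 'v::ab_group_add) \<Rightarrow> _)"
proof -
  interpret module scl by (rule assms)
  show ?thesis
    by standard
      (auto simp: pointwise_scale_def fun_eq_iff scale_right_distrib scale_left_distrib)
qed

text \<open>The local Banach space of a seminorm is again a seminormed space. Hence everything proved for
  \<open>(E, p)\<close>, in particular the estimate of a functional by its dual norm, applies to local Banach spaces.\<close>

lemma (in seminormed_space) completion:
  "seminormed_space (pointwise_scale scl) (seminorm_completion E p) (seminorm_completion_norm p)"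
proof -
  interpret C: module "pointwise_scale scl :: 'a \<Rightarrow> (nat \<Rightarrow> 'v) \<Rightarrow> _"
    by (intro module_pointwise_scale module_axioms)
  show ?thesis
  proof
    have "0 \<in> seminorm_completion E p"
      using const_in_completion[OF subspace_0[OF subspace]] by (simp add: zero_fun_def)
    then show "C.subspace (seminorm_completion E p)"
      by (intro C.subspaceI completion_add completion_scale)
    show "seminorm_on (pointwise_scale scl) (seminorm_completion E p) (seminorm_completion_norm p)"
      unfolding seminorm_on_def
    proof (intro conjI ballI allI)
      fix u assume u: "u \<in> seminorm_completion E p"
      show "0 \<le> seminorm_completion_norm p u"
        using completion_norm_tendsto[OF u] completionD(1)[OF u]
        by (intro LIMSEQ_le_const) (auto intro: nonneg)
      show "seminorm_completion_norm p (pointwise_scale scl c u)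
          = norm c * seminorm_completion_norm p u" for c
        using completionD(1)[OF u]
        by (intro completion_norm_eqI[OF completion_scale[OF u]])
           (auto simp: pointwise_scale_def homogeneous
             intro!: tendsto_mult_left completion_norm_tendsto[OF u])
      fix v assume v: "v \<in> seminorm_completion E p"
      show "seminorm_completion_norm p (u + v)
          \<le> seminorm_completion_norm p u + seminorm_completion_norm p v"
        using completionD(1)[OF u] completionD(1)[OF v]
        by (intro LIMSEQ_le[OF completion_norm_tendsto[OF completion_add[OF u v]]
              tendsto_add[OF completion_norm_tendsto[OF u] completion_norm_tendsto[OF v]]])
           (auto intro: triangle)
    qed
  qed
qed

text \<open>The supremum defining the dual norm only sees the unit ball of \<open>p\<close>. Scaling by positive reals
  extends the bound to all of \<open>E\<close>; where \<open>p x = 0\<close>, every multiple of \<open>x\<close> lies in the unit ball,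
  which forces \<open>f x = 0\<close>.\<close>

lemma (in seminormed_space) norm_le_dual_norm:
  assumes f: "linear_functional_on scl E f" and fin: "dual_norm E p f < \<infinity>" and x: "x \<in> E"
  shows "norm (f x) \<le> enn2real (dual_norm E p f) * p x"
proof -
  define D where "D = enn2real (dual_norm E p f)"
  have unit_ball: "norm (f y) \<le> D" if "y \<in> E" "p y \<le> 1" for y
  proof -
    have "ennreal (norm (f y)) \<le> dual_norm E p f"
      unfolding dual_norm_def using that by (intro SUP_upper) auto
    also have "\<dots> = ennreal D" using fin by (simp add: D_def less_top)
    finally show ?thesis by (simp add: D_def)
  qed
  have scaled: "r * norm (f x) \<le> D" if "r \<ge> 0" "r * p x \<le> 1" for r
    using unit_ball[of "scl (of_real r) x"] f x that subspace_scale[OF subspace x]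
    by (simp add: linear_functional_on_def homogeneous norm_mult)
  show ?thesis
  proof (cases "p x = 0")
    case True
    have "norm (f x) \<le> 0"
    proof (rule ccontr)
      assume "\<not> norm (f x) \<le> 0"
      moreover have "D \<ge> 0" by (simp add: D_def)
      ultimately show False
        using scaled[of "(D + 1) / norm (f x)"] True by auto
    qed
    then show ?thesis using True by simp
  next
    case False
    then have "p x > 0" using nonneg[OF x] by simp
    then show ?thesis using scaled[of "1 / p x"] by (simp add: D_def field_simps)
  qed
qed

lemma dual_norm_leI:
  assumes "\<And>x. x \<in> E \<Longrightarrow> p x \<le> 1 \<Longrightarrow> norm (f x) \<le> c"
  shows "dual_norm E p f \<le> ennreal c"
  unfolding dual_norm_def using assms by (intro SUP_least) (auto intro: ennreal_leI)

section \<open>Norms and truncations in Koethe spaces\<close>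

locale koethe_matrix =
  fixes A :: "nat \<Rightarrow> nat \<Rightarrow> real"
  assumes pos: "1 \<le> k \<Longrightarrow> 1 \<le> n \<Longrightarrow> 0 < A k n"
    and mono: "1 \<le> k \<Longrightarrow> k \<le> l \<Longrightarrow> 1 \<le> n \<Longrightarrow> A k n \<le> A l n"

definition unit_seq :: "nat \<Rightarrow> nat \<Rightarrow> 'a::real_normed_field" where
  "unit_seq n = (\<lambda>m. if m = n then 1 else 0)"

definition truncate :: "nat \<Rightarrow> (nat \<Rightarrow> 'a) \<Rightarrow> nat \<Rightarrow> 'a::real_normed_field" where
  "truncate N x = (\<lambda>n. if 1 \<le> n \<and> n \<le> N then x n else 0)"

lemma sum_fun_apply: "(\<Sum>i\<in>S. f i) x = (\<Sum>i\<in>S. f i x)"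
  by (induction S rule: infinite_finite_induct) auto

text \<open>A truncation is a finite combination of unit sequences, in the shape in which
  the definition of a nuclear map presents its partial sums.\<close>

lemma truncate_eq_sum: "truncate N x = (\<Sum>j<N. seq_scale (x (Suc j)) (unit_seq (Suc j)))"
proof
  fix n
  show "truncate N x n = (\<Sum>j<N. seq_scale (x (Suc j)) (unit_seq (Suc j))) n"
  proof (cases n)
    case 0
    then show ?thesis
      by (simp add: truncate_def sum_fun_apply pointwise_scale_def unit_seq_def)
  next
    case (Suc i)
    have "(\<Sum>j<N. seq_scale (x (Suc j)) (unit_seq (Suc j))) n = (\<Sum>j<N. if i = j then x (Suc j) else 0)"
      unfolding sum_fun_apply pointwise_scale_def unit_seq_def Suc by (intro sum.cong) auto
    then show ?thesis using Suc by (auto simp: truncate_def)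
  qed
qed

lemma summable_on_atLeast_1_iff:
  fixes f :: "nat \<Rightarrow> real"
  assumes "\<And>n. 1 \<le> n \<Longrightarrow> 0 \<le> f n"
  shows "f summable_on {1..} \<longleftrightarrow> summable (\<lambda>j. f (Suc j))"
proof -
  have "{1..} = range Suc" by (auto simp: image_def Suc_le_eq gr0_conv_Suc)
  then have "f summable_on {1..} \<longleftrightarrow> (\<lambda>j. f (Suc j)) summable_on UNIV"
    by (simp add: summable_on_reindex o_def)
  then show ?thesis using assms by (simp add: summable_on_UNIV_nonneg_real_iff)
qed

context koethe_matrix
begin

lemma norm_term_nonneg: "1 \<le> k \<Longrightarrow> 1 \<le> n \<Longrightarrow> 0 \<le> norm (x n) * A k n"
  using pos[of k n] by simp

lemma summable_terms: "x \<in> koethe_space A \<Longrightarrow> 1 \<le> k \<Longrightarrow> (\<lambda>n. norm (x n) * A k n) summable_on {1..}"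
  by (simp add: koethe_space_def)

lemma sum_le_norm:
  assumes "x \<in> koethe_space A" "1 \<le> k" "finite F" "F \<subseteq> {1..}"
  shows "(\<Sum>n\<in>F. norm (x n) * A k n) \<le> koethe_norm A k x"
  unfolding koethe_norm_def
  by (rule finite_sum_le_infsum) (use assms summable_terms norm_term_nonneg in auto)

lemma coordinate_le_norm:
  assumes "x \<in> koethe_space A" "1 \<le> k" "1 \<le> n"
  shows "norm (x n) * A k n \<le> koethe_norm A k x"
  using sum_le_norm[of x k "{n}"] assms by simp

lemma norm_le_if_dominated:
  assumes y: "y \<in> koethe_space A" and kl: "1 \<le> k" "1 \<le> l"
    and c: "c \<ge> 0" and le: "\<And>n. 1 \<le> n \<Longrightarrow> norm (x n) * A k n \<le> c * (norm (y n) * A l n)"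
  shows "koethe_norm A k x \<le> c * koethe_norm A l y"
proof -
  have s: "(\<lambda>n. c * (norm (y n) * A l n)) summable_on {1..}"
    using summable_terms[OF y kl(2)] by (intro summable_on_cmult_right)
  have xs: "(\<lambda>n. norm (x n) * A k n) summable_on {1..}"
    by (rule summable_on_comparison_test[OF s]) (use le kl norm_term_nonneg in auto)
  show "koethe_norm A k x \<le> c * koethe_norm A l y"
    unfolding koethe_norm_def infsum_cmult_right'[symmetric]
    by (rule infsum_mono[OF xs s]) (use le in auto)
qed

lemma norm_mono:
  assumes "x \<in> koethe_space A" "1 \<le> k" "k \<le> l"
  shows "koethe_norm A k x \<le> koethe_norm A l x"
proof -
  have "koethe_norm A k x \<le> 1 * koethe_norm A l x"
    using assms mono
    by (intro norm_le_if_dominated) (auto simp: koethe_space_def intro!: mult_left_mono)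
  then show ?thesis by simp
qed

lemma unit_seq_has_sum:
  "1 \<le> n \<Longrightarrow> ((\<lambda>m. norm (unit_seq n m :: 'a::real_normed_field) * A k m) has_sum A k n) {1..}"
  by (rule has_sum_finite_neutralI[of "{n}"]) (auto simp: unit_seq_def)

lemma unit_seq_in_space: "1 \<le> n \<Longrightarrow> unit_seq n \<in> koethe_space A"
  using unit_seq_has_sum by (auto simp: koethe_space_def unit_seq_def summable_on_def)

lemma norm_unit_seq: "1 \<le> n \<Longrightarrow> koethe_norm A k (unit_seq n :: nat \<Rightarrow> 'a::real_normed_field) = A k n"
  unfolding koethe_norm_def by (rule infsumI) (rule unit_seq_has_sum)

lemma seminormed_space:
  assumes k: "1 \<le> k"
  shows "seminormed_space seq_scale (koethe_space A :: (nat \<Rightarrow> 'a::real_normed_field) set) (koethe_norm A k)"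
proof -
  have "module ((*) :: 'a \<Rightarrow> 'a \<Rightarrow> 'a)"
    by standard (auto simp: algebra_simps)
  then interpret module "seq_scale :: 'a \<Rightarrow> (nat \<Rightarrow> 'a) \<Rightarrow> _"
    by (rule module_pointwise_scale)
  have add: "(\<lambda>n. norm (x n) * A l n + norm (y n) * A l n) summable_on {1..}"
      "(\<lambda>n. norm ((x + y) n) * A l n) summable_on {1..}"
      "norm ((x + y) n) * A l n \<le> norm (x n) * A l n + norm (y n) * A l n \<or> n = 0"
    if "x \<in> koethe_space A" "y \<in> koethe_space A" "1 \<le> l" for x y :: "nat \<Rightarrow> 'a" and l n
  proof -
    show s: "(\<lambda>n. norm (x n) * A l n + norm (y n) * A l n) summable_on {1..}"
      using that by (intro summable_on_add summable_terms)
    have le: "norm ((x + y) n) * A l n \<le> norm (x n) * A l n + norm (y n) * A l n \<or> n = 0" for n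
      using mult_right_mono[OF norm_triangle_ineq[of "x n" "y n"], of "A l n"] pos[of l n] that
      by (cases "n = 0") (auto simp: distrib_right)
    then show "norm ((x + y) n) * A l n \<le> norm (x n) * A l n + norm (y n) * A l n \<or> n = 0" .
    show "(\<lambda>n. norm ((x + y) n) * A l n) summable_on {1..}"
    proof (rule summable_on_comparison_test[OF s])
      show "norm ((x + y) n) * A l n \<le> norm (x n) * A l n + norm (y n) * A l n"
        if "n \<in> {1..}" for n using le[of n] that by auto
      show "0 \<le> norm ((x + y) n) * A l n" if "n \<in> {1..}" for n
        using norm_term_nonneg[of l n "x + y"] \<open>1 \<le> l\<close> that by auto
    qed
  qed
  show ?thesis
  proof
    show "subspace (koethe_space A :: (nat \<Rightarrow> 'a) set)"
      using add(2)
      by (intro subspaceI)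
         (auto simp: koethe_space_def pointwise_scale_def norm_mult mult.assoc
           intro: summable_on_cmult_right)
    show "seminorm_on seq_scale (koethe_space A :: (nat \<Rightarrow> 'a) set) (koethe_norm A k)"
      unfolding seminorm_on_def
    proof (intro conjI ballI allI)
      fix x :: "nat \<Rightarrow> 'a" assume x: "x \<in> koethe_space A"
      show "0 \<le> koethe_norm A k x"
        unfolding koethe_norm_def using k norm_term_nonneg by (intro infsum_nonneg) auto
      show "koethe_norm A k (seq_scale c x) = norm c * koethe_norm A k x" for c
        by (simp add: koethe_norm_def pointwise_scale_def norm_mult mult.assoc
            infsum_cmult_right')
      fix y :: "nat \<Rightarrow> 'a" assume y: "y \<in> koethe_space A"
      have "koethe_norm A k (x + y)
          \<le> (\<Sum>\<^sub>\<infinity>n\<in>{1..}. norm (x n) * A k n + norm (y n) * A k n)"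
        unfolding koethe_norm_def using add(3)[OF x y k]
        by (intro infsum_mono add(1,2) x y k) force
      also have "\<dots> = koethe_norm A k x + koethe_norm A k y"
        unfolding koethe_norm_def by (intro infsum_add summable_terms x y k)
      finally show "koethe_norm A k (x + y) \<le> koethe_norm A k x + koethe_norm A k y" .
    qed
  qed
qed

lemma truncate_in_space: "truncate N x \<in> koethe_space A"
proof -
  have "((\<lambda>n. norm (truncate N x n) * A k n) has_sum (\<Sum>n\<in>{1..N}. norm (truncate N x n) * A k n)) {1..}"
    for k by (rule has_sum_finite_neutralI[of "{1..N}"]) (auto simp: truncate_def)
  then show ?thesis by (auto simp: koethe_space_def truncate_def summable_on_def)
qed

lemma norm_truncate: "koethe_norm A k (truncate N x) = (\<Sum>n=1..N. norm (x n) * A k n)"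
  unfolding koethe_norm_def
  by (intro infsumI has_sum_finite_neutralI[of "{1..N}"]) (auto simp: truncate_def intro!: sum.cong)

text \<open>The ratio \<open>A k n / A l n\<close> controls how fast truncations converge: the \<open>k\<close>-norm of the tail
  of \<open>x\<close> is at most the \<open>l\<close>-norm of \<open>x\<close> times any upper bound \<open>c\<close> of the ratio over the tail.\<close>

lemma norm_diff_truncate_le:
  assumes x: "x \<in> koethe_space A" and kl: "1 \<le> k" "1 \<le> l"
    and c: "c \<ge> 0" and le: "\<And>n. n > N \<Longrightarrow> A k n \<le> c * A l n"
  shows "koethe_norm A k (x - truncate N x) \<le> c * koethe_norm A l x"
proof (rule norm_le_if_dominated[OF x kl c])
  fix n :: nat assume n: "1 \<le> n"
  show "norm ((x - truncate N x) n) * A k n \<le> c * (norm (x n) * A l n)"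
  proof (cases "n \<le> N")
    case True
    then show ?thesis using n c norm_term_nonneg[of l n x] kl by (simp add: truncate_def)
  next
    case False
    then show ?thesis using mult_left_mono[OF le[of n], of "norm (x n)"] 
      by (simp add: truncate_def mult_ac)
  qed
qed

text \<open>The unit sequences form a Schauder basis, so a continuous functional is determined by its
  values on them.\<close>

lemma truncate_tendsto:
  assumes x: "x \<in> koethe_space A" and k: "1 \<le> k"
  shows "(\<lambda>N. koethe_norm A k (x - truncate N x)) \<longlonglongrightarrow> 0"
proof -
  let ?f = "\<lambda>n. norm (x n) * A k n"
  have tail: "koethe_norm A k (x - truncate N x) = infsum ?f {1..} - sum ?f {1..N}" for N
  proof -
    have "koethe_norm A k (x - truncate N x) = infsum ?f ({1..} - {1..N})"
      unfolding koethe_norm_def by (rule infsum_cong_neutral) (auto simp: truncate_def)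
    also have "\<dots> = infsum ?f {1..} - infsum ?f {1..N}"
      by (rule infsum_Diff) (use summable_terms[OF x k] in auto)
    finally show ?thesis by simp
  qed
  have "filterlim (\<lambda>N. {1..N}) (finite_subsets_at_top {1..}) sequentially"
    unfolding filterlim_finite_subsets_at_top
  proof (intro allI impI)
    fix F :: "nat set" assume F: "finite F \<and> F \<subseteq> {1..}"
    then obtain M where M: "\<forall>n\<in>F. n \<le> M" using finite_nat_set_iff_bounded_le by auto
    show "\<forall>\<^sub>F N in sequentially. finite {1..N} \<and> F \<subseteq> {1..N} \<and> {1..N} \<subseteq> {1..}"
      by (rule eventually_mono[OF eventually_ge_at_top[of M]]) (use F M in force)
  qed
  then have "(\<lambda>N. sum ?f {1..N}) \<longlonglongrightarrow> infsum ?f {1..}"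
    using has_sum_infsum[OF summable_terms[OF x k]] unfolding has_sum_def
    by (rule filterlim_compose[rotated])
  then have "(\<lambda>N. infsum ?f {1..} - sum ?f {1..N}) \<longlonglongrightarrow> infsum ?f {1..} - infsum ?f {1..}"
    by (intro tendsto_diff tendsto_const)
  then show ?thesis by (simp add: tail)
qed


section \<open>The Grothendieck--Pietsch criterion\<close>

lemma continuous_seminorm_scaled:
  assumes "1 \<le> k" "0 < C"
  shows "continuous_seminorm seq_scale (koethe_space A :: (nat \<Rightarrow> 'a::real_normed_field) set)
    (koethe_norm A) (\<lambda>x. C * koethe_norm A k x)"
proof -
  interpret seminormed_space seq_scale "koethe_space A :: (nat \<Rightarrow> 'a) set" "koethe_norm A k"
    by (rule seminormed_space) fact
  show ?thesis
    unfolding continuous_seminorm_def seminorm_on_def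
    using assms triangle mult_left_mono[OF triangle, of _ _ C]
    by (auto simp: nonneg homogeneous distrib_left)
qed

text \<open>Let \<open>p\<close> be the \<open>k\<close>-norm and let \<open>\<Sum>\<^sub>j \<phi>\<^sub>j(u) v\<^sub>j\<close> represent the
  canonical map from the local Banach space of \<open>q \<le> C \<parallel>\<cdot>\<parallel>\<^sub>l\<close> to that of \<open>p\<close>. The \<open>n\<close>-th coordinate of
  the expansion of the unit sequence \<open>e\<^sub>n\<close> reads \<open>1 = \<Sum>\<^sub>j \<phi>\<^sub>j(e\<^sub>n) (v\<^sub>j)\<^sub>n\<close>, and
  \<open>|\<phi>\<^sub>j(e\<^sub>n)| \<le> C \<parallel>\<phi>\<^sub>j\<parallel> A l n\<close>. Multiplying by \<open>A k n / A l n\<close> and summing over \<open>n\<close> gives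
  \<open>\<Sum>\<^sub>n A k n / A l n \<le> C \<Sum>\<^sub>j \<parallel>\<phi>\<^sub>j\<parallel> p(v\<^sub>j) < \<infinity>\<close>.

  The \<open>v\<^sub>j\<close> are Cauchy sequences of elements of the space. The estimate is made for
  the \<open>m\<close>-th members of these sequences, for finitely many \<open>n\<close> and finitely many \<open>j\<close>, and the limits \<open>m \<rightarrow> \<infinity>\<close>
  and then \<open>N \<rightarrow> \<infinity>\<close> are taken at the end, so that coordinates are only taken of elements of the space itself.\<close>

lemma summable_ratio_if_nuclear:
  assumes nuc: "nuclear_space seq_scale (koethe_space A :: (nat \<Rightarrow> 'a::real_normed_field) set)
      (koethe_norm A)"
    and k: "1 \<le> k"
  shows "\<exists>l\<ge>1. (\<lambda>n. A k n / A l n) summable_on {1..}"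
proof -
  let ?E = "koethe_space A :: (nat \<Rightarrow> 'a) set" and ?p = "koethe_norm A k :: (nat \<Rightarrow> 'a) \<Rightarrow> real"
  let ?scl = "pointwise_scale (seq_scale :: 'a \<Rightarrow> _)"
  have "continuous_seminorm seq_scale ?E (koethe_norm A) ?p"
    using continuous_seminorm_scaled[OF k, of 1] by simp
  then obtain q
    where q: "continuous_seminorm seq_scale ?E (koethe_norm A) q"
      and T: "nuclear_map ?scl (seminorm_completion ?E q) (seminorm_completion_norm q)
        ?scl (seminorm_completion ?E ?p) (seminorm_completion_norm ?p) (\<lambda>u. u)"
    using nuc unfolding nuclear_space_def by blast
  let ?Eq = "seminorm_completion ?E q" and ?Ep = "seminorm_completion ?E ?p"
  let ?nq = "seminorm_completion_norm q" and ?np = "seminorm_completion_norm ?p"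
  from T obtain \<phi> :: "nat \<Rightarrow> (nat \<Rightarrow> nat \<Rightarrow> 'a) \<Rightarrow> 'a" and v :: "nat \<Rightarrow> nat \<Rightarrow> nat \<Rightarrow> 'a"
    where lin: "\<And>j. linear_functional_on ?scl ?Eq (\<phi> j)"
      and bounded: "\<And>j. dual_norm ?Eq ?nq (\<phi> j) < \<infinity>"
      and v: "\<And>j. v j \<in> ?Ep"
      and fin: "(\<Sum>j. dual_norm ?Eq ?nq (\<phi> j)
          * ennreal (?np (v j))) < \<infinity>"
      and conv: "\<And>u. u \<in> ?Eq \<Longrightarrow>
        (\<lambda>N. ?np (u - (\<Sum>j<N. ?scl (\<phi> j u) (v j)))) \<longlonglongrightarrow> 0"
    unfolding nuclear_map_def by blast
  obtain l C where l: "1 \<le> l" and C: "0 < C" and qle: "\<And>x. x \<in> ?E \<Longrightarrow> q x \<le> C * koethe_norm A l x"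
    using q unfolding continuous_seminorm_def by blast
  interpret P: seminormed_space seq_scale ?E ?p by (rule seminormed_space[OF k])
  interpret Q: seminormed_space seq_scale ?E q
    by unfold_locales (use q P.subspace in \<open>auto simp: continuous_seminorm_def\<close>)
  interpret cP: seminormed_space ?scl "?Ep" "?np"
    by (rule P.completion)
  interpret cQ: seminormed_space ?scl "?Eq" "?nq"
    by (rule Q.completion)
  define D where "D j = enn2real (dual_norm ?Eq ?nq (\<phi> j))"
    for j
  define M where "M = enn2real (\<Sum>j. dual_norm ?Eq ?nq (\<phi> j)
          * ennreal (?np (v j)))"
  have D: "0 \<le> D j" "dual_norm ?Eq ?nq (\<phi> j) = ennreal (D j)" for j
    using bounded[of j] by (auto simp: D_def less_top)
  have partial_sum: "(\<Sum>j<N. D j * ?np (v j)) \<le> M" for N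
  proof -
    have "ennreal (\<Sum>j<N. D j * ?np (v j))
        = (\<Sum>j<N. dual_norm ?Eq ?nq (\<phi> j)
          * ennreal (?np (v j)))"
      using D(1) cP.nonneg[OF v] by (simp add: D(2) ennreal_mult flip: sum_ennreal)
    also have "\<dots> \<le> ennreal M"
      using fin sum_le_suminf[OF summableI, of "{..<N}"] by (simp add: M_def less_top)
    finally show ?thesis by (simp add: M_def)
  qed
  let ?\<delta> = "\<lambda>n. (\<lambda>_. unit_seq n) :: nat \<Rightarrow> nat \<Rightarrow> 'a"
  have \<delta>: "?\<delta> n \<in> ?Eq" "?\<delta> n \<in> ?Ep" if "1 \<le> n" for n
    using that unit_seq_in_space by (auto intro: Q.const_in_completion P.const_in_completion)
  have \<phi>_unit: "norm (\<phi> j (?\<delta> n)) \<le> D j * (C * A l n)" if n: "1 \<le> n" for j n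
  proof -
    have "norm (\<phi> j (?\<delta> n)) \<le> D j * ?nq (?\<delta> n)"
      unfolding D_def by (intro cQ.norm_le_dual_norm lin bounded \<delta> n)
    also have "?nq (?\<delta> n) = q (unit_seq n)"
      by (intro Q.completion_norm_const unit_seq_in_space n)
    also have "\<dots> \<le> C * A l n"
      using qle[OF unit_seq_in_space] n by (simp add: norm_unit_seq)
    finally show ?thesis using D(1) by (simp add: mult_left_mono)
  qed
  \<comment> \<open>The error of the \<open>N\<close>-th partial sum of the expansion of the \<open>n\<close>-th unit sequence.\<close>
  define w where "w n N = ?\<delta> n - (\<Sum>j<N. ?scl (\<phi> j (?\<delta> n)) (v j))" for n N
  have w: "w n N \<in> ?Ep" if "1 \<le> n" for n N
    unfolding w_def
    by (intro cP.subspace_diff[OF cP.subspace] cP.subspace_sum[OF cP.subspace]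
        cP.subspace_scale[OF cP.subspace] \<delta> that v)
  have ratio: "A k n / A l n
      \<le> koethe_norm A k (w n N m) / A l n + C * (\<Sum>j<N. D j * (norm (v j m n) * A k n))"
    if n: "1 \<le> n" for n N m
  proof -
    have "(1 :: 'a) = w n N m n + (\<Sum>j<N. \<phi> j (?\<delta> n) * v j m n)"
      by (simp add: w_def sum_fun_apply pointwise_scale_def unit_seq_def)
    then have "norm (1 :: 'a) \<le> norm (w n N m n) + norm (\<Sum>j<N. \<phi> j (?\<delta> n) * v j m n)"
      by (metis norm_triangle_ineq)
    also have "norm (\<Sum>j<N. \<phi> j (?\<delta> n) * v j m n) \<le> (\<Sum>j<N. D j * (C * A l n) * norm (v j m n))"
      by (intro order.trans[OF norm_sum] sum_mono) (use \<phi>_unit[OF n] in \<open>auto simp: norm_mult intro: mult_right_mono\<close>)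
    finally have "A k n / A l n * 1
        \<le> A k n / A l n * (norm (w n N m n) + (\<Sum>j<N. D j * (C * A l n) * norm (v j m n)))"
      using pos[OF k n] pos[OF l n] by (intro mult_left_mono) auto
    also have "\<dots> = norm (w n N m n) * A k n / A l n + C * (\<Sum>j<N. D j * (norm (v j m n) * A k n))"
      using pos[OF l n] by (simp add: distrib_left sum_distrib_left mult_ac)
    also have "norm (w n N m n) * A k n / A l n \<le> koethe_norm A k (w n N m) / A l n"
      using pos[OF l n] coordinate_le_norm[OF P.completionD(1)[OF w[OF n]] k n]
      by (intro divide_right_mono) auto
    finally show ?thesis by simp
  qed
  have bound: "(\<Sum>n\<in>F. A k n / A l n) \<le> C * M" if F: "finite F" "F \<subseteq> {1..}" for F
  proof -
    have F1: "1 \<le> n" if "n \<in> F" for n using F that by auto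
    have nz: "A l n \<noteq> 0" if "n \<in> F" for n using pos[OF l F1[OF that]] by simp
    have step: "(\<Sum>n\<in>F. A k n / A l n) \<le> (\<Sum>n\<in>F. koethe_norm A k (w n N m) / A l n)
        + C * (\<Sum>j<N. D j * koethe_norm A k (v j m))" for N m
    proof -
      have "(\<Sum>n\<in>F. A k n / A l n) \<le> (\<Sum>n\<in>F. koethe_norm A k (w n N m) / A l n)
          + (\<Sum>n\<in>F. C * (\<Sum>j<N. D j * (norm (v j m n) * A k n)))"
        unfolding sum.distrib[symmetric] by (intro sum_mono ratio F1)
      also have "(\<Sum>n\<in>F. C * (\<Sum>j<N. D j * (norm (v j m n) * A k n)))
          = C * (\<Sum>j<N. D j * (\<Sum>n\<in>F. norm (v j m n) * A k n))"
        unfolding sum_distrib_left by (rule sum.swap)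
      also have "\<dots> \<le> C * (\<Sum>j<N. D j * koethe_norm A k (v j m))"
        using C D(1) F
        by (intro mult_left_mono sum_mono sum_le_norm P.completionD(1)[OF v] k) auto
      finally show ?thesis by simp
    qed
    \<comment> \<open>The limit \<open>m \<rightarrow> \<infinity>\<close> turns norms of members into completion norms.\<close>
    have "(\<Sum>n\<in>F. A k n / A l n) \<le> (\<Sum>n\<in>F. ?np (w n N) / A l n) + C * M" for N
    proof -
      have "(\<Sum>n\<in>F. A k n / A l n) \<le> (\<Sum>n\<in>F. ?np (w n N) / A l n)
          + C * (\<Sum>j<N. D j * ?np (v j))"
      proof (rule LIMSEQ_le_const)
        show "(\<lambda>m. (\<Sum>n\<in>F. koethe_norm A k (w n N m) / A l n)
            + C * (\<Sum>j<N. D j * koethe_norm A k (v j m)))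
          \<longlonglongrightarrow> (\<Sum>n\<in>F. ?np (w n N) / A l n)
            + C * (\<Sum>j<N. D j * ?np (v j))"
          by (intro tendsto_add tendsto_sum tendsto_divide tendsto_mult tendsto_const
              P.completion_norm_tendsto w v F1 nz)
      qed (use step in blast)
      also have "\<dots> \<le> (\<Sum>n\<in>F. ?np (w n N) / A l n) + C * M"
        using C partial_sum[of N] by simp
      finally show ?thesis .
    qed
    \<comment> \<open>The limit \<open>N \<rightarrow> \<infinity>\<close> removes the error terms.\<close>
    moreover have "(\<lambda>N. (\<Sum>n\<in>F. ?np (w n N) / A l n) + C * M)
        \<longlonglongrightarrow> (\<Sum>n\<in>F. 0 / A l n) + C * M"
      unfolding w_def
      by (intro tendsto_add tendsto_sum tendsto_divide tendsto_const conv \<delta> F1 nz)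
    ultimately show ?thesis
      using LIMSEQ_le_const by fastforce
  qed
  have "(\<lambda>n. A k n / A l n) summable_on {1..}"
  proof (rule nonneg_bdd_above_summable_on)
    show "0 \<le> A k n / A l n" if "n \<in> {1..}" for n
      using pos[OF k, of n] pos[OF l, of n] that by simp
    show "bdd_above (sum (\<lambda>n. A k n / A l n) ` {F. F \<subseteq> {1..} \<and> finite F})"
      using bound by (intro bdd_aboveI2[where M = "C * M"]) auto
  qed
  with l show ?thesis by blast
qed


text \<open>Completeness of the scalar field enters here: it gives every element of a local Banach space
  coordinates.\<close>

lemma completion_coordinate_tendsto:
  fixes u :: "nat \<Rightarrow> nat \<Rightarrow> 'a::{real_normed_field,banach}"
  assumes u: "u \<in> seminorm_completion (koethe_space A) (koethe_norm A l)" and l: "1 \<le> l" and n: "1 \<le> n"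
  shows "(\<lambda>m. u m n) \<longlonglongrightarrow> lim (\<lambda>m. u m n)"
proof -
  interpret seminormed_space seq_scale "koethe_space A :: (nat \<Rightarrow> 'a) set" "koethe_norm A l"
    by (rule seminormed_space[OF l])
  have "Cauchy (\<lambda>m. u m n)"
  proof (rule metric_CauchyI)
    fix e :: real assume "e > 0"
    then have "e * A l n > 0" using pos[OF l n] by simp
    then obtain N where N: "\<And>i j. i \<ge> N \<Longrightarrow> j \<ge> N \<Longrightarrow> koethe_norm A l (u i - u j) < e * A l n"
      using completionD(2)[OF u] by blast
    have "dist (u i n) (u j n) < e" if "i \<ge> N" "j \<ge> N" for i j
    proof -
      have "norm ((u i - u j) n) * A l n \<le> koethe_norm A l (u i - u j)"
        by (intro coordinate_le_norm subspace_diff[OF subspace] completionD(1)[OF u] l n)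
      also have "\<dots> < e * A l n" using that by (rule N)
      finally show ?thesis using pos[OF l n] by (simp add: dist_norm)
    qed
    then show "\<exists>N. \<forall>i\<ge>N. \<forall>j\<ge>N. dist (u i n) (u j n) < e" by blast
  qed
  then show ?thesis
    using Cauchy_convergent_iff convergent_LIMSEQ_iff by blast
qed

text \<open>If \<open>p \<le> C \<parallel>\<cdot>\<parallel>\<^sub>k\<close> and \<open>\<Sum>\<^sub>n A k n / A l n\<close> is finite, take \<open>q = C \<parallel>\<cdot>\<parallel>\<^sub>l\<close>. The canonical map between the
  local Banach spaces is the coordinate expansion \<open>u = \<Sum>\<^sub>n \<pi>\<^sub>n(u) e\<^sub>n\<close>. The coordinate functional \<open>\<pi>\<^sub>n\<close> has dual norm
  at most \<open>1 / (C A l n)\<close> and \<open>p(e\<^sub>n) \<le> C A k n\<close>, so the series of products is dominated by that of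
  the ratios.\<close>

lemma nuclear_if_summable_ratio:
  assumes ratio: "\<And>k. 1 \<le> k \<Longrightarrow> \<exists>l\<ge>k. (\<lambda>n. A k n / A l n) summable_on {1..}"
  shows "nuclear_space seq_scale (koethe_space A :: (nat \<Rightarrow> 'a::{real_normed_field,banach}) set)
    (koethe_norm A)"
  unfolding nuclear_space_def
proof (intro allI impI)
  let ?E = "koethe_space A :: (nat \<Rightarrow> 'a) set"
  let ?scl = "pointwise_scale (seq_scale :: 'a \<Rightarrow> _)"
  fix p assume p: "continuous_seminorm seq_scale ?E (koethe_norm A) p"
  then obtain k C where k: "1 \<le> k" and C: "0 < C" and ple: "\<And>x. x \<in> ?E \<Longrightarrow> p x \<le> C * koethe_norm A k x"
    unfolding continuous_seminorm_def by blast
  obtain l where kl: "k \<le> l" and r: "(\<lambda>n. A k n / A l n) summable_on {1..}"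
    using ratio[OF k] by blast
  have l: "1 \<le> l" using k kl by simp
  define q :: "(nat \<Rightarrow> 'a) \<Rightarrow> real" where "q x = C * koethe_norm A l x" for x
  interpret L: seminormed_space seq_scale ?E "koethe_norm A l" by (rule seminormed_space[OF l])
  interpret K: seminormed_space seq_scale ?E "koethe_norm A k" by (rule seminormed_space[OF k])
  have q: "continuous_seminorm seq_scale ?E (koethe_norm A) q"
    unfolding q_def by (rule continuous_seminorm_scaled[OF l C])
  interpret P: seminormed_space seq_scale ?E p
    by unfold_locales (use p L.subspace in \<open>auto simp: continuous_seminorm_def\<close>)
  interpret Q: seminormed_space seq_scale ?E q
    by unfold_locales (use q L.subspace in \<open>auto simp: continuous_seminorm_def\<close>)
  interpret cP: seminormed_space ?scl "seminorm_completion ?E p" "seminorm_completion_norm p"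
    by (rule P.completion)
  have pq: "p x \<le> q x" if "x \<in> ?E" for x
    using ple[OF that] norm_mono[OF that k kl] C by (simp add: q_def order.trans)
  have Q_completionD: "u \<in> seminorm_completion ?E (koethe_norm A l)" "u \<in> seminorm_completion ?E p"
    if u: "u \<in> seminorm_completion ?E q" for u
  proof -
    show "u \<in> seminorm_completion ?E (koethe_norm A l)"
      unfolding seminorm_completion_def
    proof (intro CollectI conjI allI impI Q.completionD(1)[OF u])
      fix e :: real assume "e > 0"
      then show "\<exists>N. \<forall>m\<ge>N. \<forall>n\<ge>N. koethe_norm A l (u m - u n) < e"
        using Q.completionD(2)[OF u, of "C * e"] C by (simp add: q_def)
    qed
    show "u \<in> seminorm_completion ?E p"
      unfolding seminorm_completion_def
    proof (intro CollectI conjI allI impI Q.completionD(1)[OF u])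
      fix e :: real assume "e > 0"
      then obtain N where "\<forall>m\<ge>N. \<forall>n\<ge>N. q (u m - u n) < e"
        using Q.completionD(2)[OF u] by blast
      moreover have "p (u m - u n) \<le> q (u m - u n)" for m n
        by (intro pq L.subspace_diff[OF L.subspace] Q.completionD(1)[OF u])
      ultimately show "\<exists>N. \<forall>m\<ge>N. \<forall>n\<ge>N. p (u m - u n) < e"
        by (meson le_less_trans)
    qed
  qed
  define \<pi> :: "nat \<Rightarrow> (nat \<Rightarrow> nat \<Rightarrow> 'a) \<Rightarrow> 'a" where "\<pi> n u = lim (\<lambda>m. u m n)" for n u
  have \<pi>: "(\<lambda>m. u m n) \<longlonglongrightarrow> \<pi> n u" if "u \<in> seminorm_completion ?E q" "1 \<le> n" for u n
    unfolding \<pi>_def by (rule completion_coordinate_tendsto[OF Q_completionD(1)[OF that(1)] l that(2)])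
  have \<pi>_linear: "linear_functional_on ?scl (seminorm_completion ?E q) (\<pi> n)" if n: "1 \<le> n" for n
    unfolding linear_functional_on_def
  proof (intro conjI ballI allI)
    fix u assume u: "u \<in> seminorm_completion ?E q"
    show "\<pi> n (u + v) = \<pi> n u + \<pi> n v" if v: "v \<in> seminorm_completion ?E q" for v
      using tendsto_add[OF \<pi>[OF u n] \<pi>[OF v n]] \<pi>[OF Q.completion_add[OF u v] n]
      by (simp add: LIMSEQ_unique)
    show "\<pi> n (?scl c u) = c * \<pi> n u" for c
      using tendsto_mult_left[OF \<pi>[OF u n], of c] \<pi>[OF Q.completion_scale[OF u] n]
      by (auto simp: pointwise_scale_def intro: LIMSEQ_unique)
  qed
  have \<pi>_dual: "dual_norm (seminorm_completion ?E q) (seminorm_completion_norm q) (\<pi> n)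
      \<le> ennreal (1 / (C * A l n))" if n: "1 \<le> n" for n
  proof (rule dual_norm_leI)
    fix u assume u: "u \<in> seminorm_completion ?E q" and "seminorm_completion_norm q u \<le> 1"
    have "norm (\<pi> n u) * (C * A l n) \<le> seminorm_completion_norm q u"
    proof (rule LIMSEQ_le)
      show "(\<lambda>m. norm (u m n) * (C * A l n)) \<longlonglongrightarrow> norm (\<pi> n u) * (C * A l n)"
        by (intro tendsto_mult tendsto_norm tendsto_const \<pi> u n)
      show "(\<lambda>m. q (u m)) \<longlonglongrightarrow> seminorm_completion_norm q u"
        by (rule Q.completion_norm_tendsto[OF u])
      show "\<exists>N. \<forall>m\<ge>N. norm (u m n) * (C * A l n) \<le> q (u m)"
        using coordinate_le_norm[OF Q.completionD(1)[OF u] l n] C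
        by (simp add: q_def mult.left_commute)
    qed
    also have "\<dots> \<le> 1" by fact
    finally show "norm (\<pi> n u) \<le> 1 / (C * A l n)"
      using C pos[OF l n] by (simp add: field_simps)
  qed
  let ?\<delta> = "\<lambda>n. (\<lambda>_. unit_seq n) :: nat \<Rightarrow> nat \<Rightarrow> 'a"
  let ?Eq = "seminorm_completion ?E q" and ?Ep = "seminorm_completion ?E p"
  let ?nq = "seminorm_completion_norm q" and ?np = "seminorm_completion_norm p"
  have "nuclear_map ?scl ?Eq ?nq
      ?scl ?Ep ?np (\<lambda>u. u)"
    unfolding nuclear_map_def
  proof (intro exI[of _ "\<lambda>j. \<pi> (Suc j)"] exI[of _ "\<lambda>j. ?\<delta> (Suc j)"] conjI allI ballI)
    fix j
    show "linear_functional_on ?scl ?Eq (\<pi> (Suc j))"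
      by (rule \<pi>_linear) simp
    show "dual_norm ?Eq ?nq (\<pi> (Suc j)) < \<infinity>"
      using \<pi>_dual[of "Suc j"] by (simp add: le_less_trans)
    show "?\<delta> (Suc j) \<in> ?Ep"
      by (intro P.const_in_completion unit_seq_in_space) simp
  next
    have term_le: "dual_norm ?Eq ?nq (\<pi> (Suc j))
        * ennreal (?np (?\<delta> (Suc j))) \<le> ennreal (A k (Suc j) / A l (Suc j))" for j
    proof -
      have "?np (?\<delta> (Suc j)) = p (unit_seq (Suc j))"
        by (intro P.completion_norm_const unit_seq_in_space) simp
      also have "\<dots> \<le> C * A k (Suc j)"
        using ple[OF unit_seq_in_space, of "Suc j"] by (simp add: norm_unit_seq)
      finally have "dual_norm ?Eq ?nq (\<pi> (Suc j))
        * ennreal (?np (?\<delta> (Suc j)))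
        \<le> ennreal (1 / (C * A l (Suc j))) * ennreal (C * A k (Suc j))"
        by (intro mult_mono \<pi>_dual ennreal_leI) auto
      also have "\<dots> = ennreal (A k (Suc j) / A l (Suc j))"
        using C pos[OF l, of "Suc j"] pos[OF k, of "Suc j"] by (simp flip: ennreal_mult)
      finally show ?thesis .
    qed
    have "(\<Sum>j. dual_norm ?Eq ?nq (\<pi> (Suc j))
        * ennreal (?np (?\<delta> (Suc j)))) \<le> (\<Sum>j. ennreal (A k (Suc j) / A l (Suc j)))"
      by (intro suminf_le term_le summableI)
    also have "\<dots> < \<infinity>"
    proof -
      have nn: "0 \<le> A k n / A l n" if "1 \<le> n" for n
        using pos[OF k that] pos[OF l that] by simp
      have "(\<Sum>j. ennreal (A k (Suc j) / A l (Suc j))) = ennreal (\<Sum>j. A k (Suc j) / A l (Suc j))"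
        by (rule suminf_ennreal2) (use nn r summable_on_atLeast_1_iff[of "\<lambda>n. A k n / A l n"] in auto)
      then show ?thesis by simp
    qed
    finally show "(\<Sum>j. dual_norm ?Eq ?nq (\<pi> (Suc j))
        * ennreal (?np (?\<delta> (Suc j)))) < \<infinity>" .
  next
    fix u assume u: "u \<in> ?Eq"
    let ?R = "\<lambda>N. u - (\<Sum>j<N. ?scl (\<pi> (Suc j) u) (?\<delta> (Suc j)))"
    have R_in: "?R N \<in> ?Ep" for N
      by (intro cP.subspace_diff[OF cP.subspace] cP.subspace_sum[OF cP.subspace]
        cP.subspace_scale[OF cP.subspace] Q_completionD(2)[OF u] P.const_in_completion unit_seq_in_space) simp
    have R_eq: "?R N m = u m - truncate N (\<lambda>n. \<pi> n u)" for N m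
      by (simp add: sum_fun_apply pointwise_scale_def[of seq_scale] truncate_eq_sum)
    define B where "B = seminorm_completion_norm (koethe_norm A l) u"
    have B: "B \<ge> 0" and B_lim: "(\<lambda>m. koethe_norm A l (u m)) \<longlonglongrightarrow> B"
      using Q_completionD(1)[OF u] L.completion_norm_tendsto seminormed_space.nonneg[OF L.completion]
      by (auto simp: B_def)
    \<comment> \<open>The error after \<open>N\<close> terms splits into finitely many coordinates, which converge along the
      Cauchy sequence, and the tail, controlled by the bound \<open>c\<close> on the ratio.\<close>
    have R_le: "?np (?R N) \<le> C * (c * B)"
      if c: "c \<ge> 0" and tail: "\<And>n. n > N \<Longrightarrow> A k n \<le> c * A l n" for N c
    proof (rule LIMSEQ_le)
      show "(\<lambda>m. p (?R N m)) \<longlonglongrightarrow> ?np (?R N)"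
        by (rule P.completion_norm_tendsto[OF R_in])
      have "(\<lambda>m. C * ((\<Sum>n=1..N. norm (u m n - \<pi> n u) * A k n) + c * koethe_norm A l (u m)))
          \<longlonglongrightarrow> C * ((\<Sum>n=1..N. norm (\<pi> n u - \<pi> n u) * A k n) + c * B)"
        by (intro tendsto_mult tendsto_add tendsto_sum tendsto_norm tendsto_diff tendsto_const \<pi> u B_lim) auto
      then show "(\<lambda>m. C * ((\<Sum>n=1..N. norm (u m n - \<pi> n u) * A k n) + c * koethe_norm A l (u m)))
          \<longlonglongrightarrow> C * (c * B)" by simp
      have "p (?R N m) \<le> C * ((\<Sum>n=1..N. norm (u m n - \<pi> n u) * A k n) + c * koethe_norm A l (u m))" for m
      proof -
        have um: "u m \<in> ?E" by (rule Q.completionD(1)[OF u])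
        have "?R N m = truncate N (\<lambda>n. u m n - \<pi> n u) + (u m - truncate N (u m))"
          unfolding R_eq by (auto simp: truncate_def fun_eq_iff)
        then have "koethe_norm A k (?R N m)
            = koethe_norm A k (truncate N (\<lambda>n. u m n - \<pi> n u) + (u m - truncate N (u m)))"
          by (rule arg_cong)
        also have "\<dots> \<le> koethe_norm A k (truncate N (\<lambda>n. u m n - \<pi> n u))
            + koethe_norm A k (u m - truncate N (u m))"
          by (intro K.triangle truncate_in_space L.subspace_diff[OF L.subspace] um)
        also have "\<dots> \<le> (\<Sum>n=1..N. norm (u m n - \<pi> n u) * A k n) + c * koethe_norm A l (u m)"
          unfolding norm_truncate by (intro add_left_mono norm_diff_truncate_le um k l c tail)
        finally have "C * koethe_norm A k (?R N m)
            \<le> C * ((\<Sum>n=1..N. norm (u m n - \<pi> n u) * A k n) + c * koethe_norm A l (u m))"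
          by (rule mult_left_mono) (use C in simp)
        then show ?thesis
          by (rule order.trans[OF ple[OF P.completionD(1)[OF R_in]]])
      qed
      then show "\<exists>M. \<forall>m\<ge>M. p (?R N m)
          \<le> C * ((\<Sum>n=1..N. norm (u m n - \<pi> n u) * A k n) + c * koethe_norm A l (u m))" by blast
    qed
    have ratio_lim: "(\<lambda>j. A k (Suc j) / A l (Suc j)) \<longlonglongrightarrow> 0"
      by (rule summable_LIMSEQ_zero)
        (use r pos k l summable_on_atLeast_1_iff[of "\<lambda>n. A k n / A l n"] in \<open>auto simp: less_imp_le\<close>)
    show "(\<lambda>N. ?np (?R N)) \<longlonglongrightarrow> 0"
    proof (rule LIMSEQ_I)
      fix e :: real assume e: "e > 0"
      \<comment> \<open>The summand 1 keeps the denominator positive when \<open>B = 0\<close>.\<close>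
      define c where "c = e / (C * (B + 1))"
      have c: "c > 0" using e C B by (simp add: c_def)
      have "\<forall>\<^sub>F j in sequentially. A k (Suc j) / A l (Suc j) < c"
        by (rule order_tendstoD(2)[OF ratio_lim c])
      then obtain N0 where N0: "\<And>j. j \<ge> N0 \<Longrightarrow> A k (Suc j) / A l (Suc j) < c"
        by (auto simp: eventually_sequentially)
      have tail: "A k n \<le> c * A l n" if "n > N0" for n
        using N0[of "n - 1"] that pos[OF l, of n] by (cases n) (auto simp: field_simps)
      have "norm (?np (?R N) - 0) < e" if "N \<ge> N0" for N
      proof -
        have "?np (?R N) \<le> C * (c * B)"
          using that c tail by (intro R_le) auto
        also have "\<dots> < C * (c * (B + 1))" using C c B by (intro mult_strict_left_mono) auto
        also have "\<dots> = e" using C B by (simp add: c_def)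
        finally show ?thesis using cP.nonneg[OF R_in] by simp
      qed
      then show "\<exists>N0. \<forall>N\<ge>N0. norm (?np (?R N) - 0) < e" by blast
    qed
  qed
  then show "\<exists>q. continuous_seminorm seq_scale ?E (koethe_norm A) q \<and> (\<forall>x\<in>?E. p x \<le> q x) \<and>
      nuclear_map ?scl (seminorm_completion ?E q) (seminorm_completion_norm q)
        ?scl (seminorm_completion ?E p) (seminorm_completion_norm p) (\<lambda>u. u)"
    using q pq by blast
qed


text \<open>The Grothendieck--Pietsch criterion. Enlarging \<open>l\<close> only decreases the ratios, so \<open>l\<close> can be taken
  at least \<open>k\<close>.\<close>

theorem nuclear_iff_summable_ratio:
  "nuclear_space seq_scale (koethe_space A :: (nat \<Rightarrow> 'a::{real_normed_field,banach}) set) (koethe_norm A)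
    \<longleftrightarrow> (\<forall>k\<ge>1. \<exists>l\<ge>k. (\<lambda>n. A k n / A l n) summable_on {1..})"
proof (intro iffI allI impI)
  fix k :: nat assume k: "1 \<le> k"
    and "nuclear_space seq_scale (koethe_space A :: (nat \<Rightarrow> 'a) set) (koethe_norm A)"
  then obtain l where l: "1 \<le> l" and s: "(\<lambda>n. A k n / A l n) summable_on {1..}"
    using summable_ratio_if_nuclear by blast
  have "(\<lambda>n. A k n / A (max k l) n) summable_on {1..}"
  proof (rule summable_on_comparison_test[OF s])
    fix n :: nat assume "n \<in> {1..}"
    then have "0 < A k n" "0 < A l n" "A l n \<le> A (max k l) n"
      using k l pos mono by auto
    then show "A k n / A (max k l) n \<le> A k n / A l n" "0 \<le> A k n / A (max k l) n"
      by (auto intro: divide_left_mono)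
  qed
  then show "\<exists>l\<ge>k. (\<lambda>n. A k n / A l n) summable_on {1..}" by (meson max.cobounded1)
qed (use nuclear_if_summable_ratio in blast)

section \<open>Interpolation of norms and of dual norms\<close>

lemma norm_eq_0_imp:
  assumes x: "x \<in> koethe_space A" and k: "1 \<le> k" and "koethe_norm A k x = 0"
  shows "x = 0"
proof
  fix n
  show "x n = 0 n"
    using coordinate_le_norm[OF x k, of n] pos[OF k, of n] assms
    by (cases "n = 0") (auto simp: koethe_space_def mult_le_0_iff)
qed

text \<open>For \<open>0 < t < 1\<close> this is the Hoelder inequality with exponents \<open>1 / t\<close> and \<open>1 / (1 - t)\<close>. After both norms
  on the right are normalized to 1, the inequality of weighted arithmetic and geometric means holds term by term and can be
  summed.\<close>

lemma norm_interpolation: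
  fixes x :: "nat \<Rightarrow> 'a::real_normed_field"
  assumes x: "x \<in> koethe_space A" and jkl: "1 \<le> j" "1 \<le> k" "1 \<le> l" and t: "0 \<le> t" "t \<le> 1"
    and A: "\<And>n. 1 \<le> n \<Longrightarrow> A j n \<le> A k n powr t * A l n powr (1 - t)"
  shows "koethe_norm A j x \<le> koethe_norm A k x powr t * koethe_norm A l x powr (1 - t)"
proof -
  interpret K: seminormed_space seq_scale "koethe_space A :: (nat \<Rightarrow> 'a) set" "koethe_norm A k"
    by (rule seminormed_space) fact
  interpret L: seminormed_space seq_scale "koethe_space A :: (nat \<Rightarrow> 'a) set" "koethe_norm A l"
    by (rule seminormed_space) fact
  interpret J: seminormed_space seq_scale "koethe_space A :: (nat \<Rightarrow> 'a) set" "koethe_norm A j"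
    by (rule seminormed_space) fact
  define a b where "a = koethe_norm A k x" and "b = koethe_norm A l x"
  show ?thesis
  proof (cases "x = 0")
    case True
    then show ?thesis by (simp add: J.zero)
  next
    case False
    then have a: "a > 0" and b: "b > 0"
      using norm_eq_0_imp[OF x] jkl K.nonneg[OF x] L.nonneg[OF x]
      unfolding a_def b_def by (fastforce simp: less_le)+
    define T where "T = a powr t * b powr (1 - t)"
    have T: "T > 0" using a b by (simp add: T_def)
    have le: "norm (x n) * A j n
        \<le> T * (t / a) * (norm (x n) * A k n) + T * ((1 - t) / b) * (norm (x n) * A l n)"
      if n: "1 \<le> n" for n
    proof (cases "x n = 0")
      case False
      have pk: "A k n > 0" and pl: "A l n > 0" using pos n jkl by auto
      have "(A k n / a) powr t * (A l n / b) powr (1 - t) \<le> t * (A k n / a) + (1 - t) * (A l n / b)"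
        using t pk pl a b by (intro Youngs_inequality_0) auto
      moreover have "(A k n / a) powr t * (A l n / b) powr (1 - t)
          = A k n powr t * A l n powr (1 - t) / T"
        using pk pl a b by (simp add: T_def powr_divide)
      moreover have "A j n / T \<le> A k n powr t * A l n powr (1 - t) / T"
        using A[OF n] T by (intro divide_right_mono) auto
      ultimately have "A j n / T \<le> t * (A k n / a) + (1 - t) * (A l n / b)" by linarith
      then have "A j n \<le> T * (t * (A k n / a) + (1 - t) * (A l n / b))"
        using T by (simp add: pos_divide_le_eq mult.commute)
      from mult_left_mono[OF this, of "norm (x n)"] show ?thesis
        by (simp add: algebra_simps)
    qed simp
    have sk: "(\<lambda>n. T * (t / a) * (norm (x n) * A k n)) summable_on {1..}"
      and sl: "(\<lambda>n. T * ((1 - t) / b) * (norm (x n) * A l n)) summable_on {1..}"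
      by (intro summable_on_cmult_right summable_terms x jkl)+
    have "koethe_norm A j x \<le> (\<Sum>\<^sub>\<infinity>n\<in>{1..}. T * (t / a) * (norm (x n) * A k n)
        + T * ((1 - t) / b) * (norm (x n) * A l n))"
      unfolding koethe_norm_def
      by (intro infsum_mono summable_terms summable_on_add sk sl x jkl le) auto
    also have "\<dots> = T * (t / a) * a + T * ((1 - t) / b) * b"
      unfolding a_def b_def koethe_norm_def infsum_cmult_right'[symmetric]
      by (intro infsum_add) (use sk sl in \<open>auto simp: a_def b_def koethe_norm_def\<close>)
    also have "\<dots> = T * (t + (1 - t))" using a b unfolding distrib_left by simp
    also have "\<dots> = T" by simp
    finally show ?thesis unfolding T_def a_def b_def .
  qed
qed

lemma coordinate_le_dual_norm:
  fixes y :: "(nat \<Rightarrow> 'a::real_normed_field) \<Rightarrow> 'a"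
  assumes y: "linear_functional_on seq_scale (koethe_space A) y"
    and fin: "dual_norm (koethe_space A) (koethe_norm A k) y < \<infinity>" and k: "1 \<le> k" and n: "1 \<le> n"
  shows "norm (y (unit_seq n)) \<le> enn2real (dual_norm (koethe_space A) (koethe_norm A k) y) * A k n"
  using seminormed_space.norm_le_dual_norm[OF seminormed_space[OF k] y fin unit_seq_in_space[OF n]] n
  by (simp add: norm_unit_seq)

text \<open>Together with the preceding lemma this says that the dual norm is the weighted supremum norm
  \<open>sup\<^sub>n |y(e\<^sub>n)| / A q n\<close>.\<close>

lemma dual_norm_leI_coordinates:
  fixes y :: "(nat \<Rightarrow> 'a::real_normed_field) \<Rightarrow> 'a"
  assumes y: "y \<in> continuous_dual seq_scale (koethe_space A) (koethe_norm A)" and q: "1 \<le> q"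
    and c: "0 \<le> c" and le: "\<And>n. 1 \<le> n \<Longrightarrow> norm (y (unit_seq n)) \<le> c * A q n"
  shows "dual_norm (koethe_space A) (koethe_norm A q) y \<le> ennreal c"
proof (rule dual_norm_leI)
  let ?E = "koethe_space A :: (nat \<Rightarrow> 'a) set"
  fix x assume x: "x \<in> ?E" and x1: "koethe_norm A q x \<le> 1"
  obtain k C where k: "1 \<le> k" and C: "\<And>x. x \<in> ?E \<Longrightarrow> norm (y x) \<le> C * koethe_norm A k x"
    and lin: "linear_functional_on seq_scale ?E y"
    using y unfolding continuous_dual_def by blast
  interpret seminormed_space seq_scale ?E "koethe_norm A k" by (rule seminormed_space[OF k])
  have y_add: "y (u + v) = y u + y v" if "u \<in> ?E" "v \<in> ?E" for u v
    using lin that by (auto simp: linear_functional_on_def)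
  have y_scale: "y (seq_scale a u) = a * y u" if "u \<in> ?E" for a u
    using lin that by (auto simp: linear_functional_on_def)
  have y_truncate: "y (truncate N x) = (\<Sum>j<N. x (Suc j) * y (unit_seq (Suc j)))" for N
    unfolding truncate_eq_sum
  proof (induction N)
    case 0
    show ?case using y_scale[OF x, of 0] by (simp add: zero_fun_def)
  next
    case (Suc N)
    have "y ((\<Sum>j<N. seq_scale (x (Suc j)) (unit_seq (Suc j))) + seq_scale (x (Suc N)) (unit_seq (Suc N)))
      = y (\<Sum>j<N. seq_scale (x (Suc j)) (unit_seq (Suc j))) + y (seq_scale (x (Suc N)) (unit_seq (Suc N)))"
      by (intro y_add subspace_scale[OF subspace] unit_seq_in_space)
        (auto simp flip: truncate_eq_sum intro: truncate_in_space)
    also have "y (seq_scale (x (Suc N)) (unit_seq (Suc N))) = x (Suc N) * y (unit_seq (Suc N))"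
      by (intro y_scale unit_seq_in_space) simp
    finally show ?case unfolding sum.lessThan_Suc Suc.IH .
  qed
  have "norm (y x) \<le> c + C * koethe_norm A k (x - truncate N x)" for N
  proof -
    have d: "x - truncate N x \<in> ?E" by (intro subspace_diff[OF subspace] x truncate_in_space)
    have "norm (y (truncate N x)) \<le> (\<Sum>j<N. norm (x (Suc j)) * (c * A q (Suc j)))"
      unfolding y_truncate
      by (intro order.trans[OF norm_sum] sum_mono) (auto simp: norm_mult intro!: mult_left_mono le)
    also have "\<dots> = c * (\<Sum>j<N. norm (x (Suc j)) * A q (Suc j))"
      by (simp add: sum_distrib_left mult_ac)
    also have "(\<Sum>j<N. norm (x (Suc j)) * A q (Suc j)) = (\<Sum>n\<in>Suc ` {..<N}. norm (x n) * A q n)"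
      by (simp add: sum.reindex)
    also have "c * \<dots> \<le> c * 1"
      by (intro mult_left_mono order.trans[OF sum_le_norm[OF x q] x1] c) auto
    finally have "norm (y (truncate N x)) \<le> c" by simp
    moreover have "truncate N x + (x - truncate N x) = x"
      by (subst add.commute) (rule diff_add_cancel)
    then have "norm (y x) \<le> norm (y (truncate N x)) + norm (y (x - truncate N x))"
      using y_add[OF truncate_in_space d, of N x] by (metis norm_triangle_ineq)
    ultimately show ?thesis
      using C[OF d] by linarith
  qed
  moreover have "(\<lambda>N. c + C * koethe_norm A k (x - truncate N x)) \<longlonglongrightarrow> c + C * 0"
    by (intro tendsto_intros truncate_tendsto x k)
  ultimately show "norm (y x) \<le> c"
    using LIMSEQ_le_const by fastforce
qed

text \<open>A functional whose dual norm vanishes for one index is zero on every unit sequence, hence zero.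
  This rules out the product of 0 and \<open>\<infinity>\<close> in the interpolation of dual norms.\<close>

lemma dual_norm_eq_0_transfer:
  fixes y :: "(nat \<Rightarrow> 'a::real_normed_field) \<Rightarrow> 'a"
  assumes y: "y \<in> continuous_dual seq_scale (koethe_space A) (koethe_norm A)" and pq: "1 \<le> p" "1 \<le> q"
    and 0: "dual_norm (koethe_space A) (koethe_norm A p) y = 0"
  shows "dual_norm (koethe_space A) (koethe_norm A q) y = 0"
proof -
  have lin: "linear_functional_on seq_scale (koethe_space A) y"
    using y by (simp add: continuous_dual_def)
  have "dual_norm (koethe_space A) (koethe_norm A q) y \<le> ennreal 0"
    using coordinate_le_dual_norm[OF lin _ pq(1)] 0
    by (intro dual_norm_leI_coordinates y pq) auto
  then show ?thesis by simp
qed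

text \<open>Dual norms being weighted suprema, a geometric interpolation inequality between the weights passes
  to them without loss. As the weights of the dual norms are the reciprocals of the entries of the matrix, the inequality
  is reversed compared with the one for norms.\<close>

lemma dual_norm_interpolation:
  fixes y :: "(nat \<Rightarrow> 'a::real_normed_field) \<Rightarrow> 'a"
  assumes y: "y \<in> continuous_dual seq_scale (koethe_space A) (koethe_norm A)"
    and pqk: "1 \<le> p" "1 \<le> q" "1 \<le> k" and t: "0 < t" "t < 1"
    and A: "\<And>n. 1 \<le> n \<Longrightarrow> A p n powr (1 - t) * A k n powr t \<le> A q n"
  shows "dual_norm (koethe_space A) (koethe_norm A q) y
    \<le> ennpowr (dual_norm (koethe_space A) (koethe_norm A p) y) (1 - t)
      * ennpowr (dual_norm (koethe_space A) (koethe_norm A k) y) t"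
proof -
  let ?d = "\<lambda>k. dual_norm (koethe_space A) (koethe_norm A k) y"
  have lin: "linear_functional_on seq_scale (koethe_space A) y"
    using y by (simp add: continuous_dual_def)
  consider "?d p = 0 \<or> ?d k = 0" | "?d p \<noteq> 0" "?d k \<noteq> 0" "?d p = \<infinity> \<or> ?d k = \<infinity>"
    | "?d p < \<infinity>" "?d k < \<infinity>"
    by (cases "?d p = \<infinity> \<or> ?d k = \<infinity>") (auto simp: less_top[symmetric])
  then show ?thesis
  proof cases
    case 1
    then have "?d q = 0" using dual_norm_eq_0_transfer[OF y] pqk by blast
    then show ?thesis by simp
  next
    case 2
    have "ennpowr z r \<noteq> 0" if "z \<noteq> 0" for z r
      using that by (cases z) (auto simp: ennpowr_def ennreal_eq_0_iff)
    then have "ennpowr (?d p) (1 - t) * ennpowr (?d k) t = \<infinity>"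
      using 2 by (auto simp: ennpowr_def ennreal_mult_eq_top_iff)
    then show ?thesis by simp
  next
    case 3
    define a b where "a = enn2real (?d p)" and "b = enn2real (?d k)"
    have ab: "0 \<le> a" "0 \<le> b" by (auto simp: a_def b_def)
    have "norm (y (unit_seq n)) \<le> a powr (1 - t) * b powr t * A q n" if n: "1 \<le> n" for n
    proof -
      let ?u = "norm (y (unit_seq n))"
      have "?u = ?u powr (1 - t) * ?u powr t"
        by (simp flip: powr_add)
      also have "\<dots> \<le> (a * A p n) powr (1 - t) * (b * A k n) powr t"
        unfolding a_def b_def using t
        by (intro mult_mono powr_mono2 coordinate_le_dual_norm lin 3 pqk n) auto
      also have "\<dots> = a powr (1 - t) * b powr t * (A p n powr (1 - t) * A k n powr t)"
        using ab pos[OF pqk(1) n] pos[OF pqk(3) n] by (simp add: powr_mult)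
      also have "\<dots> \<le> a powr (1 - t) * b powr t * A q n"
        using A[OF n] by (intro mult_left_mono) auto
      finally show ?thesis .
    qed
    then have "?d q \<le> ennreal (a powr (1 - t) * b powr t)"
      by (intro dual_norm_leI_coordinates y pqk) auto
    also have "\<dots> = ennpowr (?d p) (1 - t) * ennpowr (?d k) t"
      using 3 by (simp add: ennpowr_def a_def b_def ennreal_mult less_top)
    finally show ?thesis .
  qed
qed

end

section \<open>The exponents of the two matrices\<close>

lemma koethe_matrix_finite_type:
  assumes "\<forall>n\<ge>1. 0 < \<alpha> n"
  shows "koethe_matrix (finite_type_matrix \<alpha>)"
proof
  fix k l n :: nat
  assume "1 \<le> k" "k \<le> l" "1 \<le> n"
  then show "finite_type_matrix \<alpha> k n \<le> finite_type_matrix \<alpha> l n"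
    using assms by (auto simp: finite_type_matrix_def intro!: divide_left_mono)
qed (simp add: finite_type_matrix_def)

text \<open>Finite nuclearity is used through the convergence of these series. The criterion yields the
  series with \<open>1 / k - 1 / l\<close> in place of \<open>1 / k\<close>, whose terms are larger.\<close>

lemma summable_exp_if_finitely_nuclear:
  assumes "finitely_nuclear TYPE('a::{real_normed_field,banach}) \<alpha>" and k: "1 \<le> k"
  shows "(\<lambda>n. exp (- \<alpha> n / real k)) summable_on {1..}"
proof -
  have \<alpha>: "\<forall>n\<ge>1. 0 < \<alpha> n"
    and nuc: "nuclear_space seq_scale (koethe_space (finite_type_matrix \<alpha>) :: (nat \<Rightarrow> 'a) set)
      (koethe_norm (finite_type_matrix \<alpha>))"
    using assms by (auto simp: finitely_nuclear_def)
  interpret koethe_matrix "finite_type_matrix \<alpha>"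
    by (rule koethe_matrix_finite_type[OF \<alpha>])
  obtain l where s: "(\<lambda>n. finite_type_matrix \<alpha> k n / finite_type_matrix \<alpha> l n) summable_on {1..}"
    using nuc k unfolding nuclear_iff_summable_ratio by blast
  show ?thesis
  proof (rule summable_on_comparison_test[OF s])
    fix n :: nat assume "n \<in> {1..}"
    then have "0 \<le> \<alpha> n / real l" using \<alpha> by (simp add: less_imp_le)
    then show "exp (- \<alpha> n / real k) \<le> finite_type_matrix \<alpha> k n / finite_type_matrix \<alpha> l n"
      by (simp add: finite_type_matrix_def flip: exp_diff)
  qed simp
qed

text \<open>Here \<open>s\<close> is the index of the block \<open>I_set s\<close> that contains the position.\<close>

definition K_exponent :: "nat \<Rightarrow> nat \<Rightarrow> real" where
  "K_exponent k s = - (1 / real k) + (if k \<le> s then 0 else 1)"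

lemma K_matrix_eq: "K_matrix \<alpha> k n = exp (K_exponent k (I_index n) * \<alpha> n)"
  by (simp add: K_matrix_def K_exponent_def)

text \<open>The bounds are uniform in the block index \<open>s\<close>: the jump by 1 only occurs upwards, so it helps
  the lower bound and costs at most 1 in the upper bound.\<close>

lemma K_exponent_gap:
  assumes "1 \<le> k" "k \<le> l"
  shows "1 / real k - 1 / real l \<le> K_exponent l s - K_exponent k s"
    and "K_exponent l s - K_exponent k s \<le> 2"
proof -
  have bounds: "1 / real k \<le> 1" "0 \<le> 1 / real l" using assms by auto
  define d :: real where "d = (if k \<le> s \<and> s < l then 1 else 0)"
  have "K_exponent l s - K_exponent k s = 1 / real k - 1 / real l + d" "0 \<le> d" "d \<le> 1"
    using assms by (auto simp: K_exponent_def d_def)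
  then show "1 / real k - 1 / real l \<le> K_exponent l s - K_exponent k s"
    "K_exponent l s - K_exponent k s \<le> 2"
    using bounds by linarith+
qed

text \<open>Both convexity inequalities, one for each of the two properties, compare a gap between neighbouring exponents with
  \<open>t\<close> times some other difference of exponents. The former is at least \<open>1 / j - 1 / (j + 1) = 2 t\<close> and the latter at most 2,
  whatever \<open>k\<close>, \<open>l\<close> and \<open>s\<close> are; this dictates the choice of \<open>t\<close>.\<close>

lemma K_exponent_interpolation:
  assumes j: "1 \<le> j" and k: "1 \<le> k" and l: "1 \<le> l"
  defines "t \<equiv> 1 / (2 * real j * real (Suc j))"
  shows "0 < t" "t < 1"
    and "K_exponent j s \<le> t * K_exponent k s + (1 - t) * K_exponent (Suc j) s"
    and "(1 - t) * K_exponent j s + t * K_exponent l s \<le> K_exponent (Suc j) s"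
proof -
  show t0: "0 < t" using j by (simp add: t_def)
  have "1 * 1 \<le> real j * real (Suc j)" using j by (intro mult_mono) auto
  then show "t < 1" by (simp add: t_def)
  have gap: "2 * t \<le> K_exponent (Suc j) s - K_exponent j s"
  proof -
    have "2 * t = 1 / real j - 1 / real (Suc j)"
      using j unfolding t_def by (simp add: divide_simps)
    then show ?thesis using K_exponent_gap(1)[of j "Suc j" s] j by simp
  qed
  have two: "K_exponent n s - K_exponent m s \<le> 2" if "1 \<le> m" "1 \<le> n" for m n
  proof (cases "m \<le> n")
    case True
    then show ?thesis using K_exponent_gap(2) that by blast
  next
    case False
    then have "1 / real m \<le> 1 / real n" using that by (simp add: frac_le)
    then show ?thesis using K_exponent_gap(1)[of n m s] that False by simp
  qed
  have "t * (K_exponent (Suc j) s - K_exponent k s) \<le> t * 2"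
    using t0 two[of k "Suc j"] k by (intro mult_left_mono) auto
  then show "K_exponent j s \<le> t * K_exponent k s + (1 - t) * K_exponent (Suc j) s"
    using gap by (simp add: algebra_simps)
  have "t * (K_exponent l s - K_exponent j s) \<le> t * 2"
    using t0 two[of j l] j l by (intro mult_left_mono) auto
  then show "(1 - t) * K_exponent j s + t * K_exponent l s \<le> K_exponent (Suc j) s"
    using gap by (simp add: algebra_simps)
qed

lemma koethe_matrix_K:
  assumes "\<forall>n\<ge>1. 0 < \<alpha> n"
  shows "koethe_matrix (K_matrix \<alpha>)"
proof
  fix k l n :: nat
  assume "1 \<le> k" "k \<le> l" "1 \<le> n"
  moreover from this have "1 / real l \<le> 1 / real k" by (intro divide_left_mono) auto
  ultimately show "K_matrix \<alpha> k n \<le> K_matrix \<alpha> l n"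
    using assms K_exponent_gap(1)[of k l "I_index n"] by (simp add: K_matrix_eq)
qed (simp add: K_matrix_eq)

theorem lemma3p2:
  fixes \<alpha> :: "nat \<Rightarrow> real"
  assumes "strict_mono_on {1..} \<alpha>"
    and "\<forall>n\<ge>1. 0 < \<alpha> n"
    and "finitely_nuclear TYPE('a::{real_normed_field,banach}) \<alpha>"
  shows "nuclear_space seq_scale (K_space \<alpha> :: (nat \<Rightarrow> 'a) set) (K_norm \<alpha>)
    \<and> property_DN (K_space \<alpha> :: (nat \<Rightarrow> 'a) set) (K_norm \<alpha>)
    \<and> property_Omega seq_scale (K_space \<alpha> :: (nat \<Rightarrow> 'a) set) (K_norm \<alpha>)"
proof (intro conjI)
  note \<alpha> = assms(2)
  interpret koethe_matrix "K_matrix \<alpha>" by (rule koethe_matrix_K[OF \<alpha>])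
  have K_powr: "K_matrix \<alpha> k n powr t = exp (t * K_exponent k (I_index n) * \<alpha> n)" for k n t
    by (simp add: K_matrix_eq powr_def mult.assoc)
  show "nuclear_space seq_scale (K_space \<alpha> :: (nat \<Rightarrow> 'a) set) (K_norm \<alpha>)"
    unfolding nuclear_iff_summable_ratio
  proof (intro allI impI)
    fix k :: nat assume k: "1 \<le> k"
    \<comment> \<open>Doubling the index works since \<open>1 / k - 1 / (2 k) = 1 / (2 k)\<close>.\<close>
    have "(\<lambda>n. K_matrix \<alpha> k n / K_matrix \<alpha> (2 * k) n) summable_on {1..}"
    proof (rule summable_on_comparison_test[OF summable_exp_if_finitely_nuclear[OF assms(3)]])
      show "1 \<le> 2 * k" using k by simp
      fix n :: nat assume n: "n \<in> {1..}"
      have "1 / real (2 * k) \<le> K_exponent (2 * k) (I_index n) - K_exponent k (I_index n)"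
        using K_exponent_gap(1)[of k "2 * k" "I_index n"] k by (simp add: field_simps)
      from mult_right_mono[OF this, of "\<alpha> n"]
      show "K_matrix \<alpha> k n / K_matrix \<alpha> (2 * k) n \<le> exp (- \<alpha> n / real (2 * k))"
        using \<alpha> n by (simp add: K_matrix_eq less_imp_le algebra_simps flip: exp_diff)
    qed (simp add: K_matrix_eq)
    then show "\<exists>l\<ge>k. (\<lambda>n. K_matrix \<alpha> k n / K_matrix \<alpha> l n) summable_on {1..}"
      by (intro exI[of _ "2 * k"]) auto
  qed
  show "property_DN (K_space \<alpha> :: (nat \<Rightarrow> 'a) set) (K_norm \<alpha>)"
    unfolding property_DN_def
  proof (rule exI[of _ 1], intro conjI allI impI)
    fix j :: nat assume j: "1 \<le> j"
    let ?t = "1 / (2 * real j * real (Suc j))"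
    have t: "0 < ?t" "?t < 1" using K_exponent_interpolation(1,2)[OF j order.refl order.refl] by auto
    have "koethe_norm (K_matrix \<alpha>) j x \<le> 1 * koethe_norm (K_matrix \<alpha>) 1 x powr ?t
        * koethe_norm (K_matrix \<alpha>) (Suc j) x powr (1 - ?t)" if "x \<in> K_space \<alpha>" for x :: "nat \<Rightarrow> 'a"
      unfolding mult_1
    proof (rule norm_interpolation[OF that j])
      fix n :: nat assume n: "1 \<le> n"
      from mult_right_mono[OF K_exponent_interpolation(3)[OF j order.refl order.refl, of "I_index n"], of "\<alpha> n"]
      show "K_matrix \<alpha> j n \<le> K_matrix \<alpha> 1 n powr ?t * K_matrix \<alpha> (Suc j) n powr (1 - ?t)"
        using \<alpha> n unfolding K_powr by (simp add: K_matrix_eq less_imp_le distrib_right flip: exp_add)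
    qed (use t in auto)
    then show "\<exists>l\<ge>1. \<exists>C>0. \<exists>t. 0 < t \<and> t < 1 \<and> (\<forall>x\<in>K_space \<alpha> :: (nat \<Rightarrow> 'a) set.
        K_norm \<alpha> j x \<le> C * K_norm \<alpha> 1 x powr t * K_norm \<alpha> l x powr (1 - t))"
      using t by (intro exI[of _ "Suc j"] exI[of _ 1] exI[of _ ?t] conjI) auto
  qed simp
  show "property_Omega seq_scale (K_space \<alpha> :: (nat \<Rightarrow> 'a) set) (K_norm \<alpha>)"
    unfolding property_Omega_def
  proof (intro allI impI)
    fix p :: nat assume p: "1 \<le> p"
    let ?t = "1 / (2 * real p * real (Suc p))"
    have t: "0 < ?t" "?t < 1" using K_exponent_interpolation(1,2)[OF p order.refl order.refl] by auto
    have "dual_norm (K_space \<alpha>) (K_norm \<alpha> (Suc p)) y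
        \<le> ennreal 1 * ennpowr (dual_norm (K_space \<alpha>) (K_norm \<alpha> p) y) (1 - ?t)
          * ennpowr (dual_norm (K_space \<alpha>) (K_norm \<alpha> k) y) ?t"
      if k: "1 \<le> k" and y: "y \<in> continuous_dual seq_scale (K_space \<alpha>) (K_norm \<alpha>)"
      for k and y :: "(nat \<Rightarrow> 'a) \<Rightarrow> 'a"
      unfolding ennreal_1 mult_1
    proof (rule dual_norm_interpolation[OF y p _ k t])
      fix n :: nat assume n: "1 \<le> n"
      from mult_right_mono[OF K_exponent_interpolation(4)[OF p order.refl k, of "I_index n"], of "\<alpha> n"]
      show "K_matrix \<alpha> p n powr (1 - ?t) * K_matrix \<alpha> k n powr ?t \<le> K_matrix \<alpha> (Suc p) n"
        using \<alpha> n unfolding K_powr by (simp add: K_matrix_eq less_imp_le distrib_right flip: exp_add)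
    qed simp
    then show "\<exists>q\<ge>1. \<forall>k\<ge>1. \<exists>C>0. \<exists>\<theta>. 0 < \<theta> \<and> \<theta> < 1 \<and>
        (\<forall>y\<in>continuous_dual seq_scale (K_space \<alpha> :: (nat \<Rightarrow> 'a) set) (K_norm \<alpha>).
          dual_norm (K_space \<alpha>) (K_norm \<alpha> q) y
            \<le> ennreal C * ennpowr (dual_norm (K_space \<alpha>) (K_norm \<alpha> p) y) (1 - \<theta>)
              * ennpowr (dual_norm (K_space \<alpha>) (K_norm \<alpha> k) y) \<theta>)"
      using t by (intro exI[of _ "Suc p"] conjI allI impI exI[of _ "1::real"] exI[of _ ?t]) auto
  qed
qed

end
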